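(* Let $S$ be a densely defined, symmetric, gapped operator on an infinite-dimensional complex Hilbert space $\mathcal{H}$, with gap $(a,b)$, and assume that $S$ has infinite deficiency index. For any arbitrary closed subset $K$ of the closure of the gap $(a,b)$ there is a self-adjoint extension of $S$ in $\mathcal{H}$ whose essential spectrum contains $K$.
   Context: The scalar product $\langle\cdot,\cdot\rangle$ is anti-linear in the first entry; $\mathcal{D}(A)$ is the domain of $A$. A densely defined symmetric operator $S$ has gap $(a,b)$, with $-\infty\leqslant a<b<+\infty$, if for all $f\in\mathcal{D}(S)$: $\langle f,Sf\rangle\geqslant b\|f\|^2$ when $a=-\infty$, and $\|(S-\frac{a+b}{2}\mathbf{1})f\|\geqslant\frac{b-a}{2}\|f\|$ when $a>-\infty$. For such $S$ the dimension of $\ker(S^*-z\mathbf{1})$ is the same for all $z\in(\mathbb{C}\setminus\mathbb{R})\cup(a,b)$ and is called the deficiency index of $S$. The closure of the gap is taken in $\mathbb{R}$. No separability of $\mathcal{H}$ is assumed. *)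

theory Defs
  imports "HOL-Analysis.Analysis"
begin

section \<open>Complex Hilbert spaces\<close>

text \<open>
  The library has real inner product spaces only. A complex Hilbert space is a complete
  real inner product space that carries a multiplication by complex scalars and a
  sesquilinear form whose real part is the given real inner product. The norm
  is then the one induced by the complex form, and positive definiteness is inherited from
  the class \<open>real_inner\<close>.
\<close>

class complex_hilbert = real_inner + complete_space +
  fixes scaleC :: "complex \<Rightarrow> 'a \<Rightarrow> 'a"  (infixr \<open>*\<^sub>C\<close> 75)
    and cinner :: "'a \<Rightarrow> 'a \<Rightarrow> complex"
  assumes scaleC_of_real: "of_real r *\<^sub>C x = r *\<^sub>R x"
    and scaleC_add_right: "z *\<^sub>C (x + y) = z *\<^sub>C x + z *\<^sub>C y"
    and scaleC_add_left: "(z + w) *\<^sub>C x = z *\<^sub>C x + w *\<^sub>C x"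
    and scaleC_scaleC: "z *\<^sub>C w *\<^sub>C x = (z * w) *\<^sub>C x"
    and cinner_commute: "cinner x y = cnj (cinner y x)"
    and cinner_add_right: "cinner x (y + y') = cinner x y + cinner x y'"
    and cinner_scaleC_right: "cinner x (z *\<^sub>C y) = z * cinner x y"
    and inner_eq_Re_cinner: "inner x y = Re (cinner x y)"

instantiation complex :: complex_hilbert
begin

definition scaleC_complex_def: "scaleC z x = z * x" for z x :: complex
definition cinner_complex_def: "cinner x y = cnj x * y" for x y :: complex

instance
  by standard
    (simp_all add: scaleC_complex_def cinner_complex_def scaleR_conv_of_real
       algebra_simps inner_complex_def)

end

global_interpretation cvs: vector_space "scaleC :: complex \<Rightarrow> 'a \<Rightarrow> 'a :: complex_hilbert"
proof
  show "1 *\<^sub>C x = x" for x :: 'a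
    using scaleC_of_real[of 1 x] by simp
qed (simp_all add: scaleC_add_right scaleC_add_left scaleC_scaleC)

definition finite_dimensional :: "'a::complex_hilbert set \<Rightarrow> bool" where
  "finite_dimensional V \<longleftrightarrow> (\<exists>B. finite B \<and> V \<subseteq> cvs.span B)"

abbreviation infinite_dimensional :: "'a::complex_hilbert set \<Rightarrow> bool" where
  "infinite_dimensional V \<equiv> \<not> finite_dimensional V"


section \<open>Unbounded operators\<close>

text \<open>
  An operator is a partial function; its domain is \<open>dom A\<close>, equality of operators includes
  equality of the domains, and \<open>T\<close> extends \<open>S\<close> iff \<open>S \<subseteq>\<^sub>m T\<close>.
\<close>

type_synonym 'a operator = "'a \<rightharpoonup> 'a"

abbreviation app :: "'a operator \<Rightarrow> 'a \<Rightarrow> 'a"  (infixl \<open>\<bullet>\<bullet>\<close> 100) where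
  "A \<bullet>\<bullet> f \<equiv> the (A f)"

definition linear_operator :: "'a::complex_hilbert operator \<Rightarrow> bool" where
  "linear_operator A \<longleftrightarrow> cvs.subspace (dom A) \<and>
     (\<forall>f\<in>dom A. \<forall>g\<in>dom A. A \<bullet>\<bullet> (f + g) = A \<bullet>\<bullet> f + A \<bullet>\<bullet> g) \<and>
     (\<forall>z. \<forall>f\<in>dom A. A \<bullet>\<bullet> (z *\<^sub>C f) = z *\<^sub>C (A \<bullet>\<bullet> f))"

definition densely_defined :: "'a::complex_hilbert operator \<Rightarrow> bool" where
  "densely_defined A \<longleftrightarrow> closure (dom A) = UNIV"

definition symmetric :: "'a::complex_hilbert operator \<Rightarrow> bool" where
  "symmetric A \<longleftrightarrow> (\<forall>f\<in>dom A. \<forall>g\<in>dom A. cinner f (A \<bullet>\<bullet> g) = cinner (A \<bullet>\<bullet> f) g)"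

text \<open>The vector \<open>h\<close> below is unique only if \<open>A\<close> is densely defined.\<close>

definition adjoint :: "'a::complex_hilbert operator \<Rightarrow> 'a operator" where
  "adjoint A = (\<lambda>g.
     if \<exists>h. \<forall>f\<in>dom A. cinner g (A \<bullet>\<bullet> f) = cinner h f
     then Some (THE h. \<forall>f\<in>dom A. cinner g (A \<bullet>\<bullet> f) = cinner h f)
     else None)"

definition self_adjoint :: "'a::complex_hilbert operator \<Rightarrow> bool" where
  "self_adjoint A \<longleftrightarrow> linear_operator A \<and> densely_defined A \<and> adjoint A = A"

text \<open>The kernel of \<open>A - z\<close>.\<close>

definition ker_shift :: "'a::complex_hilbert operator \<Rightarrow> complex \<Rightarrow> 'a set" where
  "ker_shift A z = {f \<in> dom A. A \<bullet>\<bullet> f - z *\<^sub>C f = 0}"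


section \<open>Spectrum\<close>

text \<open>The last conjunct says that the inverse of \<open>A - z\<close> is bounded.\<close>

definition resolvent_set :: "'a::complex_hilbert operator \<Rightarrow> complex set" where
  "resolvent_set A = {z. bij_betw (\<lambda>f. A \<bullet>\<bullet> f - z *\<^sub>C f) (dom A) UNIV \<and>
     (\<exists>C. \<forall>f\<in>dom A. norm f \<le> C * norm (A \<bullet>\<bullet> f - z *\<^sub>C f))}"

definition spectrum :: "'a::complex_hilbert operator \<Rightarrow> complex set" where
  "spectrum A = - resolvent_set A"

definition discrete_spectrum :: "'a::complex_hilbert operator \<Rightarrow> complex set" where
  "discrete_spectrum A = {z. z isolated_in spectrum A \<and>
     ker_shift A z \<noteq> {0} \<and> finite_dimensional (ker_shift A z)}"

text \<open>This is the usual notion for self-adjoint operators, the only ones it is used for.\<close>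

definition essential_spectrum :: "'a::complex_hilbert operator \<Rightarrow> complex set" where
  "essential_spectrum A = spectrum A - discrete_spectrum A"


section \<open>Gaps and deficiency index\<close>

definition gap_interval :: "ereal \<Rightarrow> real \<Rightarrow> real set" where
  "gap_interval a b = {x. a < ereal x \<and> x < b}"

text \<open>
  The left endpoint may be \<open>-\<infinity>\<close>. For symmetric \<open>S\<close> the number \<open>cinner f (S \<bullet>\<bullet> f)\<close> is real,
  so \<open>Re\<close> is only a type conversion.
\<close>

definition has_gap :: "'a::complex_hilbert operator \<Rightarrow> ereal \<Rightarrow> real \<Rightarrow> bool" where
  "has_gap S a b \<longleftrightarrow> a < ereal b \<and>
     (\<forall>f\<in>dom S.
        if a = -\<infinity> then Re (cinner f (S \<bullet>\<bullet> f)) \<ge> b * (norm f)\<^sup>2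
        else norm (S \<bullet>\<bullet> f - ((real_of_ereal a + b) / 2) *\<^sub>R f)
               \<ge> (b - real_of_ereal a) / 2 * norm f)"

text \<open>
  For a densely defined symmetric operator with gap \<open>(a, b)\<close> the dimension of the kernel of
  \<open>S\<^sup>* - z\<close> does not depend on the point \<open>z\<close> of
  \<open>(\<complex> - \<real>) \<union> (a, b)\<close>; this common dimension is the deficiency index. It is infinite as soon as
  one of the kernels is infinite-dimensional; the definition does not presuppose
  the independence of \<open>z\<close>.
\<close>

definition infinite_deficiency_index ::
    "'a::complex_hilbert operator \<Rightarrow> ereal \<Rightarrow> real \<Rightarrow> bool" where
  "infinite_deficiency_index S a b \<longleftrightarrow>
     (\<exists>z \<in> (- \<real>) \<union> complex_of_real ` gap_interval a b.
        infinite_dimensional (ker_shift (adjoint S) z))"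

end

theory Submission
  imports Defs
begin

text \<open>
  If \<open>S\<close> has a self-adjoint extension \<open>T\<close> whose eigenvalues are dense in the gap, then every
  point of the closure of the gap is a limit point of the spectrum of \<open>T\<close>, hence lies in its
  essential spectrum. To obtain \<open>T\<close>, enumerate the rationals \<open>l n\<close> of the gap and choose
  orthonormal vectors \<open>u n\<close> in the kernels of \<open>S\<^sup>* - l n\<close>. These kernels are all
  infinite-dimensional, because this property of the kernel of \<open>S\<^sup>* - z\<close> is locally constant on
  the connected set of nonreal points and points of the gap. The gap condition, written as
  \<open>p \<parallel>S f\<parallel>\<^sup>2 + q \<langle>f, S f\<rangle> + r \<parallel>f\<parallel>\<^sup>2 \<ge> 0\<close> with a polynomial \<open>p x\<^sup>2 + q x + r\<close> negative on the gap,
  is inherited by the compression of \<open>S\<close> to the orthogonal complement of the \<open>u n\<close>. So for \<open>c\<close>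
  in the gap the inverse of the compression of \<open>S - c\<close> is bounded and symmetric, and any extension
  of it to an everywhere defined symmetric operator \<open>B\<close> provides the self-adjoint operator
  \<open>c + B\<inverse>\<close> on the complement; \<open>T\<close> is its sum with the diagonal operator on the \<open>u n\<close>.
\<close>

section \<open>The complex inner product\<close>

lemma cinner_scaleC_left: "cinner (z *\<^sub>C x) y = cnj z * cinner x y"
  for x y :: "'a::complex_hilbert"
  by (metis cinner_commute cinner_scaleC_right complex_cnj_mult)

lemma cinner_self: "cinner x x = of_real ((norm x)\<^sup>2)" for x :: "'a::complex_hilbert"
proof (rule complex_eqI)
  show "Re (cinner x x) = Re (of_real ((norm x)\<^sup>2))"
    by (simp flip: inner_eq_Re_cinner add: power2_norm_eq_inner)
  have "Im (cinner x x) = - Im (cinner x x)"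
    using arg_cong[OF cinner_commute[of x x], of Im] by simp
  then show "Im (cinner x x) = Im (of_real ((norm x)\<^sup>2))" by simp
qed

lemma norm_scaleC: "norm (z *\<^sub>C x) = cmod z * norm x" for x :: "'a::complex_hilbert"
proof -
  have "(norm (z *\<^sub>C x))\<^sup>2 = Re (cinner (z *\<^sub>C x) (z *\<^sub>C x))"
    by (simp add: power2_norm_eq_inner inner_eq_Re_cinner)
  also have "\<dots> = Re (cnj z * (z * of_real ((norm x)\<^sup>2)))"
    by (simp only: cinner_scaleC_left cinner_scaleC_right cinner_self[of x] mult.left_commute)
  also have "\<dots> = (cmod z * norm x)\<^sup>2"
    unfolding power_mult_distrib cmod_power2 by (simp add: algebra_simps power2_eq_square)
  finally have "(norm (z *\<^sub>C x))\<^sup>2 = (cmod z * norm x)\<^sup>2" .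
  then show ?thesis by (simp add: power2_eq_iff_nonneg)
qed

text \<open>Multiplying \<open>x\<close> by the phase \<open>e\<close> of \<open>cinner x y\<close>
  makes the form real and nonnegative, so the real Cauchy-Schwarz inequality applies.\<close>

lemma cmod_cinner_le: "cmod (cinner x y) \<le> norm x * norm y" for x y :: "'a::complex_hilbert"
proof (cases "cinner x y = 0")
  case False
  define e where "e = cinner x y / cmod (cinner x y)"
  have e: "cmod e = 1" using False by (simp add: e_def norm_divide)
  have "cinner (e *\<^sub>C x) y = cnj (cinner x y) * cinner x y / cmod (cinner x y)"
    by (simp add: cinner_scaleC_left e_def)
  also have "\<dots> = of_real (cmod (cinner x y))"
    using False by (simp add: power2_eq_square mult.commute flip: complex_norm_square)
  finally have "cmod (cinner x y) = inner (e *\<^sub>C x) y" by (simp add: inner_eq_Re_cinner)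
  also have "\<dots> \<le> norm (e *\<^sub>C x) * norm y" by (rule norm_cauchy_schwarz)
  finally show ?thesis by (simp add: norm_scaleC e)
qed auto

text \<open>Cauchy-Schwarz gives continuity. Only real scalars are treated, since the first slot is
  conjugate-linear.\<close>

interpretation cinner: bounded_bilinear "cinner :: 'a::complex_hilbert \<Rightarrow> 'a \<Rightarrow> complex"
proof
  fix x y x' y' :: 'a and r :: real
  show "cinner (x + x') y = cinner x y + cinner x' y"
    by (metis cinner_commute cinner_add_right complex_cnj_add)
  show "cinner x (y + y') = cinner x y + cinner x y'" by (rule cinner_add_right)
  show "cinner (r *\<^sub>R x) y = r *\<^sub>R cinner x y"
    by (simp add: cinner_scaleC_left scaleR_conv_of_real flip: scaleC_of_real)
  show "cinner x (r *\<^sub>R y) = r *\<^sub>R cinner x y"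
    by (simp add: cinner_scaleC_right scaleR_conv_of_real flip: scaleC_of_real)
  show "\<exists>K. \<forall>x y :: 'a. cmod (cinner x y) \<le> norm x * norm y * K"
    by (rule exI[of _ 1]) (simp add: cmod_cinner_le)
qed

lemma cinner_eqI: "x = y" if "\<And>z. cinner x z = cinner y z" for x y :: "'a::complex_hilbert"
proof -
  have "cinner (x - y) (x - y) = 0" by (simp add: cinner.diff_left that)
  then show ?thesis by (simp add: cinner_self)
qed

lemma closed_cinner_eq: "closed {x. cinner y x = cinner z x}" for y z :: "'a::complex_hilbert"
  by (intro closed_Collect_eq cinner.continuous_on continuous_intros)

lemma cinner_eq_closure:
  fixes y z :: "'a::complex_hilbert"
  assumes "\<And>x. x \<in> V \<Longrightarrow> cinner y x = cinner z x" "x \<in> closure V"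
  shows "cinner y x = cinner z x"
  using closure_minimal[OF _ closed_cinner_eq[of y z], of V] assms by auto

lemma eq_if_cinner_eq_dense:
  fixes x y :: "'a::complex_hilbert"
  assumes "closure V = UNIV" "\<And>v. v \<in> V \<Longrightarrow> cinner x v = cinner y v"
  shows "x = y"
  using cinner_eqI cinner_eq_closure[of V x y] assms by auto

section \<open>Representation of functionals\<close>

text \<open>The vector \<open>e\<close> is the limit of a minimising sequence of \<open>\<parallel>X d\<parallel>\<^sup>2 - 2 * \<psi> d\<close>.\<close>

lemma riesz_real:
  fixes X :: "'b::real_vector \<Rightarrow> 'a::{real_inner,complete_space}"
  assumes D: "subspace D"
    and X: "\<And>d d'. d \<in> D \<Longrightarrow> d' \<in> D \<Longrightarrow> X (d + d') = X d + X d'"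
       "\<And>r d. d \<in> D \<Longrightarrow> X (r *\<^sub>R d) = r *\<^sub>R X d"
    and \<psi>: "\<And>d d'. d \<in> D \<Longrightarrow> d' \<in> D \<Longrightarrow> \<psi> (d + d') = \<psi> d + \<psi> d'"
       "\<And>r d. d \<in> D \<Longrightarrow> \<psi> (r *\<^sub>R d) = r * \<psi> d"
    and bound: "\<And>d. d \<in> D \<Longrightarrow> \<psi> d \<le> C * norm (X d)"
  obtains e where "e \<in> closure (X ` D)" "\<And>d. d \<in> D \<Longrightarrow> inner e (X d) = \<psi> d"
proof -
  define J where "J d = (norm (X d))\<^sup>2 - 2 * \<psi> d" for d
  have bdd: "bdd_below (J ` D)"
  proof (rule bdd_belowI2)
    fix d assume d: "d \<in> D"
    have "0 \<le> (norm (X d) - C)\<^sup>2" by simp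
    then show "- C\<^sup>2 \<le> J d"
      using bound[OF d] by (simp add: J_def power2_diff mult.commute)
  qed
  define m where "m = Inf (J ` D)"
  have m_le: "m \<le> J d" if "d \<in> D" for d
    unfolding m_def using bdd that by (intro cInf_lower) auto
  have "\<exists>d\<in>D. J d < m + \<epsilon>" if "\<epsilon> > 0" for \<epsilon>
    using cInf_lessD[of "J ` D" "m + \<epsilon>"] that subspace_0[OF D] by (auto simp: m_def)
  then have "\<forall>n. \<exists>d\<in>D. J d < m + 1 / real (Suc n)" by simp
  then obtain s where s: "\<And>n. s n \<in> D" "\<And>n. J (s n) < m + 1 / real (Suc n)" by metis
  \<comment> \<open>The midpoint of \<open>d\<close> and \<open>d'\<close> lies in \<open>D\<close>,
    so \<open>J\<close> is at least \<open>m\<close> there; the parallelogram law turns this into a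
    distance estimate. It makes \<open>X (s n)\<close> Cauchy, with no claim about
    \<open>s n\<close> itself.\<close>
  have pgram: "(norm (X d - X d'))\<^sup>2 \<le> 2 * (J d - m) + 2 * (J d' - m)" if "d \<in> D" "d' \<in> D" for d d'
  proof -
    have in_D: "d + d' \<in> D" using D that by (rule subspace_add)
    then have "m \<le> J ((1/2) *\<^sub>R (d + d'))" using D m_le subspace_scale by blast
    also have "\<dots> = (norm (X d + X d'))\<^sup>2 / 4 - \<psi> d - \<psi> d'"
      using in_D that by (simp add: J_def X \<psi> power_divide add_divide_distrib)
    finally have "4 * m \<le> (norm (X d + X d'))\<^sup>2 - 4 * \<psi> d - 4 * \<psi> d'" by simp
    moreover have "(norm (X d - X d'))\<^sup>2 + (norm (X d + X d'))\<^sup>2 = 2 * (norm (X d))\<^sup>2 + 2 * (norm (X d'))\<^sup>2"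
      by (simp add: power2_norm_eq_inner inner_add_left inner_add_right inner_diff_left
          inner_diff_right inner_commute)
    ultimately show ?thesis by (simp add: J_def)
  qed
  have "Cauchy (\<lambda>n. X (s n))"
  proof (rule metric_CauchyI)
    fix \<epsilon> :: real assume "\<epsilon> > 0"
    then obtain M where M: "1 / real (Suc M) < \<epsilon>\<^sup>2 / 4"
      by (metis nat_approx_posE zero_less_power divide_pos_pos zero_less_numeral)
    have "dist (X (s i)) (X (s j)) < \<epsilon>" if "i \<ge> M" "j \<ge> M" for i j
    proof -
      have "1 / real (Suc i) \<le> 1 / real (Suc M)" "1 / real (Suc j) \<le> 1 / real (Suc M)"
        using that by (auto simp: field_simps)
      then have "J (s i) < m + \<epsilon>\<^sup>2 / 4" "J (s j) < m + \<epsilon>\<^sup>2 / 4"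
        using s(2)[of i] s(2)[of j] M by (smt (verit))+
      then have "(norm (X (s i) - X (s j)))\<^sup>2 < \<epsilon>\<^sup>2"
        using pgram[OF s(1) s(1), of i j] by argo
      then show ?thesis
        using \<open>\<epsilon> > 0\<close> by (metis dist_norm less_imp_le power2_less_imp_less)
    qed
    then show "\<exists>M. \<forall>i\<ge>M. \<forall>j\<ge>M. dist (X (s i)) (X (s j)) < \<epsilon>" by blast
  qed
  then obtain e where e: "(\<lambda>n. X (s n)) \<longlonglongrightarrow> e" using Cauchy_convergent convergent_def by blast
  have "(\<lambda>n. J (s n)) \<longlonglongrightarrow> m"
  proof (rule tendsto_sandwich[of "\<lambda>_. m" _ _ "\<lambda>n. m + 1 / real (Suc n)"])
    show "(\<lambda>n. m + 1 / real (Suc n)) \<longlonglongrightarrow> m"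
      using tendsto_add[OF tendsto_const[of m] LIMSEQ_inverse_real_of_nat]
      by (simp add: inverse_eq_divide)
    show "\<forall>\<^sub>F n in sequentially. J (s n) \<le> m + 1 / real (Suc n)" 
      using s(2) by (simp add: less_imp_le)
  qed (use s m_le in auto)
  \<comment> \<open>\<open>J\<close> is at least \<open>m\<close> at
    \<open>s n + t *\<^sub>R d\<close>; as \<open>n\<close> tends to infinity, a quadratic in
    \<open>t\<close> without constant term remains.\<close>
  have var: "0 \<le> 2 * t * (inner e (X d) - \<psi> d) + t\<^sup>2 * (norm (X d))\<^sup>2" if d: "d \<in> D" for d t
  proof -
    have td: "t *\<^sub>R d \<in> D" using D d by (rule subspace_scale)
    have *: "m \<le> J (s n) + (2 * t * (inner (X (s n)) (X d) - \<psi> d) + t\<^sup>2 * (norm (X d))\<^sup>2)" for n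
    proof -
      have "(norm (X (s n) + t *\<^sub>R X d))\<^sup>2 =
          (norm (X (s n)))\<^sup>2 + 2 * t * inner (X (s n)) (X d) + t\<^sup>2 * (norm (X d))\<^sup>2"
        unfolding power2_norm_eq_inner
        by (simp add: inner_add_left inner_add_right inner_commute algebra_simps power2_eq_square)
      then show ?thesis
        using m_le[OF subspace_add[OF D s(1)[of n] td]] td s(1)[of n] d
        by (simp add: J_def X \<psi> algebra_simps)
    qed
    have "(\<lambda>n. J (s n) + (2 * t * (inner (X (s n)) (X d) - \<psi> d) + t\<^sup>2 * (norm (X d))\<^sup>2)) \<longlonglongrightarrow>
        m + (2 * t * (inner e (X d) - \<psi> d) + t\<^sup>2 * (norm (X d))\<^sup>2)"
      by (intro tendsto_intros e \<open>(\<lambda>n. J (s n)) \<longlonglongrightarrow> m\<close>)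
    from LIMSEQ_le_const[OF this, of m] * show ?thesis by auto
  qed
  have "inner e (X d) = \<psi> d" if d: "d \<in> D" for d
  proof -
    define \<delta> where "\<delta> = inner e (X d) - \<psi> d"
    define n where "n = (norm (X d))\<^sup>2"
    have n: "n \<ge> 0" by (simp add: n_def)
    \<comment> \<open>The choice \<open>t = - \<delta> / (n + 1)\<close> makes the quadratic
      negative unless \<open>\<delta> = 0\<close>; \<open>n + 1\<close> in place of \<open>n\<close>
      covers \<open>X d = 0\<close>.\<close>
    have "0 \<le> 2 * (- \<delta> / (n + 1)) * \<delta> + (- \<delta> / (n + 1))\<^sup>2 * n"
      using var[OF d] unfolding \<delta>_def n_def .
    also have "\<dots> = - (\<delta>\<^sup>2 * (n + 2)) / (n + 1)\<^sup>2"
      using n by (simp add: divide_simps power2_eq_square) (simp add: algebra_simps)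
    finally have "\<delta>\<^sup>2 * (n + 2) \<le> 0"
      using n by (simp add: divide_le_0_iff zero_le_divide_iff)
    then have "\<delta> = 0" using n by (simp add: mult_le_0_iff)
    then show ?thesis by (simp add: \<delta>_def)
  qed
  moreover have "e \<in> closure (X ` D)"
    using e s(1) unfolding closure_sequential by (intro exI[of _ "\<lambda>n. X (s n)"]) auto
  ultimately show thesis using that by blast
qed


text \<open>Linearity is asked on \<open>D\<close> only, because the total function underlying a
  partial operator carries no information off the domain.\<close>

definition clinear_on :: "'b::complex_hilbert set \<Rightarrow> ('b \<Rightarrow> 'a::complex_hilbert) \<Rightarrow> bool" where
  "clinear_on D X \<longleftrightarrow> cvs.subspace D \<and> (\<forall>d\<in>D. \<forall>d'\<in>D. X (d + d') = X d + X d') \<and>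
     (\<forall>z. \<forall>d\<in>D. X (z *\<^sub>C d) = z *\<^sub>C X d)"

lemma subspace_of_cvs_subspace: "cvs.subspace D \<Longrightarrow> subspace D"
  for D :: "'a::complex_hilbert set"
  unfolding subspace_def cvs.subspace_def by (auto simp flip: scaleC_of_real)

lemma clinear_onD:
  assumes "clinear_on D X"
  shows "cvs.subspace D" "subspace D"
    "d \<in> D \<Longrightarrow> d' \<in> D \<Longrightarrow> X (d + d') = X d + X d'"
    "d \<in> D \<Longrightarrow> X (z *\<^sub>C d) = z *\<^sub>C X d"
    "d \<in> D \<Longrightarrow> X (r *\<^sub>R d) = r *\<^sub>R X d"
    "d \<in> D \<Longrightarrow> d' \<in> D \<Longrightarrow> X (d - d') = X d - X d'"
proof -
  show "cvs.subspace D" and add: "d \<in> D \<Longrightarrow> d' \<in> D \<Longrightarrow> X (d + d') = X d + X d'"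
    and scale: "d \<in> D \<Longrightarrow> X (z *\<^sub>C d) = z *\<^sub>C X d" for d d' z
    using assms by (auto simp: clinear_on_def)
  show sub: "subspace D"
    using assms by (simp add: clinear_on_def subspace_of_cvs_subspace)
  show scaleR: "d \<in> D \<Longrightarrow> X (r *\<^sub>R d) = r *\<^sub>R X d" for d r
    using scale[of d "of_real r"] by (simp add: scaleC_of_real)
  show "X (d - d') = X d - X d'" if "d \<in> D" "d' \<in> D"
    using add[OF that(1) subspace_scale[OF sub that(2), of "- 1"]] scaleR[OF that(2), of "- 1"]
    by simp
qed

lemma clinear_on_UNIV:
  assumes "\<And>x y. X (x + y) = X x + X y" "\<And>z x. X (z *\<^sub>C x) = z *\<^sub>C X x"
  shows "clinear_on UNIV X"
  using assms by (simp add: clinear_on_def cvs.subspace_UNIV)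

lemma clinear_on_cinner: "clinear_on D X \<Longrightarrow> clinear_on D (\<lambda>d. cinner w (X d))"
  by (auto simp: clinear_on_def cinner.add_right cinner_scaleC_right scaleC_complex_def)

text \<open>The real version applied to \<open>Re (\<phi> d)\<close> settles the real part; its
  value at \<open>\<i> *\<^sub>C d\<close> gives the imaginary part. The bound forces
  \<open>\<phi> d\<close> to depend on \<open>X d\<close> only, so \<open>X\<close> may fail to be
  injective.\<close>

lemma riesz:
  fixes X :: "'b::complex_hilbert \<Rightarrow> 'a::complex_hilbert"
  assumes X: "clinear_on D X" and \<phi>: "clinear_on D \<phi>"
    and bound: "\<And>d. d \<in> D \<Longrightarrow> cmod (\<phi> d) \<le> C * norm (X d)"
  obtains e where "e \<in> closure (X ` D)" "\<And>d. d \<in> D \<Longrightarrow> cinner e (X d) = \<phi> d"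
proof (rule riesz_real[of D X "\<lambda>d. Re (\<phi> d)" C])
  show "Re (\<phi> d) \<le> C * norm (X d)" if "d \<in> D" for d
    using bound[OF that] complex_Re_le_cmod[of "\<phi> d"] by linarith
  fix e assume e: "e \<in> closure (X ` D)" "\<And>d. d \<in> D \<Longrightarrow> inner e (X d) = Re (\<phi> d)"
  have "cinner e (X d) = \<phi> d" if d: "d \<in> D" for d
  proof (rule complex_eqI)
    show "Re (cinner e (X d)) = Re (\<phi> d)" using e(2)[OF d] by (simp add: inner_eq_Re_cinner)
    have "\<i> *\<^sub>C d \<in> D" using d clinear_onD(1)[OF X] cvs.subspace_scale by blast
    from e(2)[OF this] show "Im (cinner e (X d)) = Im (\<phi> d)"
      using d by (simp add: inner_eq_Re_cinner clinear_onD(4)[OF X] clinear_onD(4)[OF \<phi>]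
          cinner_scaleC_right scaleC_complex_def)
  qed
  with e(1) show thesis using that by blast
qed (use clinear_onD[OF X] clinear_onD[OF \<phi>] in auto)

section \<open>Ranges of linear maps, their closures and symmetric extension\<close>

lemma cvs_subspace_image:
  assumes "clinear_on D X"
  shows "cvs.subspace (X ` D)"
  unfolding cvs.subspace_def
proof (intro conjI ballI allI)
  have D: "cvs.subspace D" using assms by (rule clinear_onD)
  show "0 \<in> X ` D"
    using clinear_onD(5)[OF assms cvs.subspace_0[OF D], of 0] cvs.subspace_0[OF D] by force
  show "x + y \<in> X ` D" if "x \<in> X ` D" "y \<in> X ` D" for x y
    using that clinear_onD(3)[OF assms] cvs.subspace_add[OF D] by (metis (no_types, lifting) image_iff)
  show "z *\<^sub>C x \<in> X ` D" if "x \<in> X ` D" for z x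
    using that clinear_onD(4)[OF assms] cvs.subspace_scale[OF D] by (metis (no_types, lifting) image_iff)
qed

lemma tendsto_scaleC: "f \<longlonglongrightarrow> x \<Longrightarrow> (\<lambda>n. z *\<^sub>C f n) \<longlonglongrightarrow> z *\<^sub>C x"
  for x :: "'a::complex_hilbert"
proof (rule bounded_linear.tendsto[of "(*\<^sub>C) z"])
  show "bounded_linear ((*\<^sub>C) z :: 'a \<Rightarrow> 'a)"
    by (rule bounded_linear_intro[of _ "cmod z"])
      (simp_all add: scaleC_add_right norm_scaleC mult.commute flip: scaleC_of_real)
qed

lemma cvs_subspace_closure:
  fixes V :: "'a::complex_hilbert set"
  assumes V: "cvs.subspace V"
  shows "cvs.subspace (closure V)"
  unfolding cvs.subspace_def
proof (intro conjI ballI allI)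
  show "0 \<in> closure V"
    using cvs.subspace_0[OF V] closure_subset by blast
  fix x assume "x \<in> closure V"
  then obtain f where f: "\<And>n. f n \<in> V" "f \<longlonglongrightarrow> x" unfolding closure_sequential by blast
  show "z *\<^sub>C x \<in> closure V" for z
    using cvs.subspace_scale[OF V] tendsto_scaleC[OF f(2), of z] f(1)
    unfolding closure_sequential by (intro exI[of _ "\<lambda>n. z *\<^sub>C f n"]) auto
  fix y assume "y \<in> closure V"
  then obtain g where g: "\<And>n. g n \<in> V" "g \<longlonglongrightarrow> y" unfolding closure_sequential by blast
  show "x + y \<in> closure V"
    using cvs.subspace_add[OF V] tendsto_add[OF f(2) g(2)] f(1) g(1)
    unfolding closure_sequential by (intro exI[of _ "\<lambda>n. f n + g n"]) auto
qed

lemma eq_if_cinner_eq_on_subspace: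
  fixes x y :: "'a::complex_hilbert"
  assumes "cvs.subspace V" "x \<in> closure V" "y \<in> closure V" "\<And>v. v \<in> V \<Longrightarrow> cinner x v = cinner y v"
  shows "x = y"
proof -
  have "x - y \<in> closure V"
    using cvs.subspace_diff[OF cvs_subspace_closure[OF assms(1)]] assms by blast
  then have "cinner x (x - y) = cinner y (x - y)"
    using cinner_eq_closure assms(4) by blast
  then have "cinner (x - y) (x - y) = 0" by (simp add: cinner.diff_left)
  then show ?thesis by (simp add: cinner_self)
qed

text \<open>
  With \<open>V\<close> the closed range of \<open>X\<close>, the relation \<open>X d \<mapsto> Y d\<close> extends to a bounded operator \<open>A\<close>
  vanishing on the orthogonal complement of \<open>V\<close>. If \<open>Q\<close> is the projection onto \<open>V\<close> and \<open>E\<close> the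
  adjoint of \<open>A\<close>, then \<open>E + A - Q A\<close> is symmetric and agrees with \<open>A\<close> on \<open>V\<close>.
\<close>

lemma symmetric_extension:
  fixes X Y :: "'b::complex_hilbert \<Rightarrow> 'a::complex_hilbert"
  assumes X: "clinear_on D X" and Y: "clinear_on D Y"
    and bound: "\<And>d. d \<in> D \<Longrightarrow> norm (Y d) \<le> C * norm (X d)" and C: "C \<ge> 0"
    and sym: "\<And>d d'. d \<in> D \<Longrightarrow> d' \<in> D \<Longrightarrow> cinner (X d) (Y d') = cinner (Y d) (X d')"
  obtains B where "\<And>x y. cinner (B x) y = cinner x (B y)" "\<And>d. d \<in> D \<Longrightarrow> B (X d) = Y d"
proof -
  let ?V = "X ` D"
  have V: "cvs.subspace ?V" using X by (rule cvs_subspace_image)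
  note V_eqI = eq_if_cinner_eq_on_subspace[OF V]
  note V_closed = cvs.subspace_add[OF cvs_subspace_closure[OF V]]
    cvs.subspace_scale[OF cvs_subspace_closure[OF V]]
  \<comment> \<open>Representatives in the closure of \<open>?V\<close> are unique, which makes
    \<open>E\<close> linear.\<close>
  have "\<exists>e\<in>closure ?V. \<forall>d\<in>D. cinner e (X d) = cinner w (Y d)" for w
  proof (rule riesz[OF X clinear_on_cinner[OF Y, of w], of "norm w * C"])
    show "cmod (cinner w (Y d)) \<le> norm w * C * norm (X d)" if "d \<in> D" for d
      using order_trans[OF cmod_cinner_le mult_left_mono[OF bound[OF that] norm_ge_zero]]
      by (simp add: mult.assoc)
  qed blast
  then obtain E where E: "\<And>w. E w \<in> closure ?V"
      "\<And>w d. d \<in> D \<Longrightarrow> cinner (E w) (X d) = cinner w (Y d)"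
    by metis
  have "\<exists>e\<in>closure ?V. \<forall>d\<in>D. cinner e (X d) = cinner w (X d)" for w
    by (rule riesz[OF X clinear_on_cinner[OF X, of w], of "norm w"]) (auto simp: cmod_cinner_le)
  then obtain Q where Q: "\<And>w. Q w \<in> closure ?V"
      "\<And>w d. d \<in> D \<Longrightarrow> cinner (Q w) (X d) = cinner w (X d)"
    by metis
  have E_lin: "clinear_on UNIV E"
    by (intro clinear_on_UNIV V_eqI V_closed E)
      (auto simp: E(2) cinner.add_left cinner_scaleC_left)
  have E_bound: "norm (E w) \<le> C * norm w" for w
  proof (cases "E w = 0")
    case False
    \<comment> \<open>The estimate on \<open>?V\<close> persists on its closure, which contains
      \<open>E w\<close>; inserting \<open>v = E w\<close> gives the norm bound.\<close>
    have "closed {v. cmod (cinner (E w) v) \<le> norm w * C * norm v}"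
      by (intro closed_Collect_le cinner.continuous_on continuous_intros)
    moreover have "?V \<subseteq> {v. cmod (cinner (E w) v) \<le> norm w * C * norm v}"
      using order_trans[OF cmod_cinner_le mult_left_mono[OF bound norm_ge_zero]]
      by (auto simp: E(2) mult.assoc)
    ultimately have "cmod (cinner (E w) (E w)) \<le> norm w * C * norm (E w)"
      using closure_minimal E(1) by blast
    then have "norm (E w) * norm (E w) \<le> (C * norm w) * norm (E w)"
      by (simp add: cinner_self power2_eq_square norm_mult mult.commute)
    then show ?thesis using False by (simp only: mult_le_cancel_right) auto
  qed (simp add: C)
  have "\<exists>e\<in>closure (range (\<lambda>x::'a. x)). \<forall>z\<in>UNIV. cinner e z = cinner x (E z)" for x
  proof (rule riesz[of UNIV "\<lambda>x. x", OF _ clinear_on_cinner[OF E_lin, of x], of "norm x * C"])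
    show "cmod (cinner x (E z)) \<le> norm x * C * norm z" for z
      using order_trans[OF cmod_cinner_le mult_left_mono[OF E_bound norm_ge_zero]]
      by (simp add: mult.assoc)
  qed (auto simp: clinear_on_UNIV)
  then obtain A where A: "\<And>x z. cinner (A x) z = cinner x (E z)" by (metis UNIV_I)
  have A': "cinner z (A x) = cinner (E z) x" for x z
    by (metis A cinner_commute)
  have Q': "cinner (Q w) v = cinner w v" if "v \<in> closure ?V" for v w
    using cinner_eq_closure[OF _ that] Q(2) by blast
  have Q'': "cinner v (Q w) = cinner v w" if "v \<in> closure ?V" for v w
    by (metis Q' cinner_commute that)
  have AQ: "A (Q x) = A x" for x
    by (rule cinner_eqI) (simp add: A Q' E(1))
  have AX: "A (X d) = Y d" if "d \<in> D" for d
    by (rule cinner_eqI) (metis A E(2) cinner_commute that)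
  \<comment> \<open>The symmetry hypothesis enters here: both sides lie in the closure of
    \<open>?V\<close> and pair equally with every \<open>X d'\<close>.\<close>
  have EX: "E (X d) = Q (Y d)" if "d \<in> D" for d
    by (rule V_eqI) (auto simp: E Q sym that)
  have E_eq_A: "cinner (E v) v' = cinner (A v) v'" if "v \<in> closure ?V" "v' \<in> closure ?V" for v v'
    by (rule cinner_eq_closure[OF _ that(2)]) (auto simp: A E EX Q'' that(1))
  \<comment> \<open>This expresses the symmetry of \<open>Q\<close> after \<open>A\<close>:
    \<open>A\<close> factors through \<open>Q\<close>, and \<open>E\<close> and \<open>A\<close>
    define the same form on the closure of \<open>?V\<close>.\<close>
  have QA: "cinner (A x) (Q z) = cinner (Q x) (A z)" for x z
  proof -
    have "cinner (A x) (Q z) = cinner (Q x) (E (Q z))" by (metis A AQ)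
    also have "\<dots> = cnj (cinner (A (Q z)) (Q x))" by (metis E_eq_A Q(1) cinner_commute)
    also have "\<dots> = cinner (Q x) (A z)" by (metis AQ cinner_commute)
    finally show ?thesis .
  qed
  show thesis
  proof (rule that)
    \<comment> \<open>The first and last terms cancel, both being \<open>Q (Y d)\<close>.\<close>
    show "E (X d) + A (X d) - Q (A (X d)) = Y d" if "d \<in> D" for d
      by (simp add: AX EX that)
    fix x y
    have "cinner (Q (A x)) y = cinner x (Q (A y))"
      by (metis Q(1) Q' Q'' QA)
    then show "cinner (E x + A x - Q (A x)) y = cinner x (E y + A y - Q (A y))"
      by (simp add: cinner.add_left cinner.add_right cinner.diff_left cinner.diff_right
          A[of x y] A'[of x y])
  qed
qed

section \<open>Orthonormal sequences\<close>

locale orthonormal_sequence =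
  fixes u :: "nat \<Rightarrow> 'a::complex_hilbert"
  assumes orthonormal: "cinner (u m) (u n) = (if m = n then 1 else 0)"
begin

text \<open>The projection orthogonal to the first \<open>N\<close> vectors. Identities are proved
  at this stage, where sums are finite, and then passed to the limit.\<close>

definition truncated_complement :: "nat \<Rightarrow> 'a \<Rightarrow> 'a" where
  "truncated_complement N x = x - (\<Sum>n<N. cinner (u n) x *\<^sub>C u n)"

lemma cinner_truncated_complement:
  "cinner y (truncated_complement N x) = cinner y x - (\<Sum>n<N. cnj (cinner (u n) y) * cinner (u n) x)"
  by (simp add: truncated_complement_def cinner.diff_right cinner.sum_right cinner_scaleC_right
      mult.commute flip: cinner_commute)

lemma cinner_u_truncated_complement:
  "cinner (u m) (truncated_complement N x) = (if m < N then 0 else cinner (u m) x)"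
proof -
  have "(\<Sum>n<N. cnj (cinner (u n) (u m)) * cinner (u n) x) =
      (\<Sum>n<N. if n = m then cinner (u m) x else 0)"
    by (rule sum.cong) (auto simp: orthonormal)
  then show ?thesis by (simp add: cinner_truncated_complement sum.delta)
qed

text \<open>The left vector is orthogonal to all \<open>u n\<close> with \<open>n < N\<close>, so
  the terms subtracted from \<open>x\<close> do not contribute.\<close>

lemma cinner_truncated_complement_both:
  assumes "M \<le> N"
  shows "cinner (truncated_complement N y) (truncated_complement M x) = cinner (truncated_complement N y) x"
  using assms
  by (simp add: cinner_truncated_complement[of "truncated_complement N y"] cinner_u_truncated_complement)

lemma truncated_complement_symmetric:
  "cinner (truncated_complement N y) x = cinner y (truncated_complement N x)"
  by (subst cinner_commute) (simp add: cinner_truncated_complement mult.commute flip: cinner_commute)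

lemma inner_truncated_complement:
  "inner (truncated_complement N y) (truncated_complement N x) =
     inner y x - (\<Sum>n<N. Re (cnj (cinner (u n) y) * cinner (u n) x))"
  unfolding inner_eq_Re_cinner cinner_truncated_complement_both[OF order_refl]
  by (simp add: truncated_complement_symmetric cinner_truncated_complement)

lemma norm_truncated_complement:
  "(norm (truncated_complement N x))\<^sup>2 = (norm x)\<^sup>2 - (\<Sum>n<N. (cmod (cinner (u n) x))\<^sup>2)"
proof -
  have Re: "Re (cnj z * z) = (cmod z)\<^sup>2" for z
    unfolding cmod_power2 by (simp add: power2_eq_square)
  show ?thesis
    unfolding power2_norm_eq_inner[of "truncated_complement N x"] inner_truncated_complement Re
    by (simp add: power2_norm_eq_inner)
qed

text \<open>By Pythagoras, squared distances between truncations are differences of squared norms,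
  and these decrease and are bounded below.\<close>

lemma convergent_truncated_complement: "convergent (\<lambda>N. truncated_complement N x)"
proof -
  let ?t = "\<lambda>N. truncated_complement N x"
  have dist: "(norm (?t M - ?t N))\<^sup>2 = (norm (?t M))\<^sup>2 - (norm (?t N))\<^sup>2" if "M \<le> N" for M N
  proof -
    have "cinner (?t N) (?t M) = cinner (?t N) (?t N)"
      by (simp add: cinner_truncated_complement_both that)
    then have "inner (?t N) (?t M) = inner (?t N) (?t N)" by (simp add: inner_eq_Re_cinner)
    then show ?thesis
      by (simp add: power2_norm_eq_inner inner_diff_left inner_diff_right inner_commute)
  qed
  have "decseq (\<lambda>N. (norm (?t N))\<^sup>2)"
    unfolding decseq_def using dist by (metis diff_ge_0_iff_ge zero_le_power2)
  then obtain L where "(\<lambda>N. (norm (?t N))\<^sup>2) \<longlonglongrightarrow> L"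
    using decseq_convergent[of "\<lambda>N. (norm (?t N))\<^sup>2" 0] by auto
  then have Cauchy: "Cauchy (\<lambda>N. (norm (?t N))\<^sup>2)" using LIMSEQ_imp_Cauchy by blast
  have "Cauchy ?t"
  proof (rule metric_CauchyI)
    fix \<epsilon> :: real assume "\<epsilon> > 0"
    then obtain K where K: "\<And>M N. M \<ge> K \<Longrightarrow> N \<ge> K \<Longrightarrow> dist ((norm (?t M))\<^sup>2) ((norm (?t N))\<^sup>2) < \<epsilon>\<^sup>2"
      using Cauchy unfolding Cauchy_def by (meson zero_less_power)
    have less: "dist (?t M) (?t N) < \<epsilon>" if "M \<le> N" "K \<le> M" for M N
    proof -
      have "(norm (?t M - ?t N))\<^sup>2 < \<epsilon>\<^sup>2"
        using K[of M N] dist[OF that(1)] that by (simp add: dist_real_def)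
      then show ?thesis
        using \<open>\<epsilon> > 0\<close> by (metis dist_norm less_imp_le power2_less_imp_less)
    qed
    have "dist (?t M) (?t N) < \<epsilon>" if "M \<ge> K" "N \<ge> K" for M N
      using less[of M N] less[of N M] that by (cases "M \<le> N") (auto simp: dist_commute)
    then show "\<exists>K. \<forall>M\<ge>K. \<forall>N\<ge>K. dist (?t M) (?t N) < \<epsilon>" by blast
  qed
  then show ?thesis by (rule Cauchy_convergent)
qed

text \<open>The orthogonal projection onto the vectors orthogonal to all \<open>u n\<close>.\<close>

definition complement :: "'a \<Rightarrow> 'a" where
  "complement x = lim (\<lambda>N. truncated_complement N x)"

lemma truncated_complement_tendsto: "(\<lambda>N. truncated_complement N x) \<longlonglongrightarrow> complement x"
  unfolding complement_def using convergent_truncated_complement convergent_LIMSEQ_iff by blast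

lemma cinner_u_complement: "cinner (u m) (complement x) = 0"
proof -
  have "(\<lambda>N. cinner (u m) (truncated_complement N x)) \<longlonglongrightarrow> cinner (u m) (complement x)"
    by (intro cinner.tendsto tendsto_const truncated_complement_tendsto)
  moreover have "(\<lambda>N. cinner (u m) (truncated_complement N x)) \<longlonglongrightarrow> 0"
    by (rule tendsto_eventually, rule eventually_sequentiallyI[of "Suc m"])
      (simp add: cinner_u_truncated_complement)
  ultimately show ?thesis by (rule LIMSEQ_unique)
qed

lemma complement_symmetric: "cinner (complement y) x = cinner y (complement x)"
proof -
  have "(\<lambda>N. cinner (truncated_complement N y) x) \<longlonglongrightarrow> cinner (complement y) x"
    by (intro cinner.tendsto tendsto_const truncated_complement_tendsto)
  moreover have "(\<lambda>N. cinner y (truncated_complement N x)) \<longlonglongrightarrow> cinner y (complement x)"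
    by (intro cinner.tendsto tendsto_const truncated_complement_tendsto)
  ultimately show ?thesis using LIMSEQ_unique by (simp add: truncated_complement_symmetric)
qed

lemma complement_id:
  assumes "\<And>n. cinner (u n) x = 0"
  shows "complement x = x"
  by (simp add: complement_def truncated_complement_def assms)

lemma complement_complement: "complement (complement x) = complement x"
  by (simp add: complement_id cinner_u_complement)

lemma complement_u: "complement (u n) = 0"
proof -
  have "cinner (complement (u n)) (complement (u n)) = 0"
    unfolding complement_symmetric by (simp add: complement_complement cinner_u_complement)
  then show ?thesis by (simp add: cinner_self)
qed

text \<open>A map that is symmetric for the form is linear: move it to the other slot, add there,
  and move it back.\<close>

lemma complement_add: "complement (x + y) = complement x + complement y"
  by (rule cinner_eqI) (simp add: complement_symmetric cinner.add_left)

lemma complement_scaleC: "complement (z *\<^sub>C x) = z *\<^sub>C complement x"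
  by (rule cinner_eqI) (simp add: complement_symmetric cinner_scaleC_left)

lemma complement_scaleR: "complement (r *\<^sub>R x) = r *\<^sub>R complement x"
  using complement_scaleC[of "of_real r"] by (simp add: scaleC_of_real)

text \<open>Both sides are limits of the same finite sums of
  \<open>l n * cnj (cinner (u n) k) * cinner (u n) f\<close>; the real factor \<open>l n\<close> may
  go to either slot. This lets symmetry pass between an operator and its compression to the
  complement.\<close>

lemma cinner_complement_shift:
  fixes l :: "nat \<Rightarrow> real"
  assumes "\<And>n. cinner (u n) g = l n * cinner (u n) f" "\<And>n. cinner (u n) h = l n * cinner (u n) k"
  shows "cinner k g - cinner k (complement g) = cinner h f - cinner h (complement f)"
proof -
  have eq: "cinner k g - cinner k (truncated_complement N g) = cinner h f - cinner h (truncated_complement N f)" for N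
    by (simp add: cinner_truncated_complement assms algebra_simps)
  have "(\<lambda>N. cinner k g - cinner k (truncated_complement N g)) \<longlonglongrightarrow> cinner k g - cinner k (complement g)"
    by (intro tendsto_intros cinner.tendsto truncated_complement_tendsto)
  moreover have "(\<lambda>N. cinner h f - cinner h (truncated_complement N f)) \<longlonglongrightarrow> cinner h f - cinner h (complement f)"
    by (intro tendsto_intros cinner.tendsto truncated_complement_tendsto)
  ultimately show ?thesis unfolding eq by (rule LIMSEQ_unique)
qed

text \<open>Removing the component along \<open>u n\<close> subtracts
  \<open>p * (l n)\<^sup>2 + q * l n + r\<close> times a square from the form. This number is not
  positive, so the form can only grow.\<close>

lemma quadratic_form_complement:
  fixes l :: "nat \<Rightarrow> real"
  assumes u: "\<And>n. cinner (u n) g = l n * cinner (u n) f"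
    and le: "\<And>n. p * (l n)\<^sup>2 + q * l n + r \<le> 0"
    and ge: "p * (norm g)\<^sup>2 + q * inner f g + r * (norm f)\<^sup>2 \<ge> 0"
  shows "p * (norm (complement g))\<^sup>2 + q * inner (complement f) (complement g)
    + r * (norm (complement f))\<^sup>2 \<ge> 0"
proof -
  have "p * (norm (truncated_complement N g))\<^sup>2 + q * inner (truncated_complement N f) (truncated_complement N g)
      + r * (norm (truncated_complement N f))\<^sup>2 \<ge> 0" (is "?F N \<ge> 0") for N
  proof -
    have Re: "Re (cnj (cinner (u n) f) * cinner (u n) g) = l n * (cmod (cinner (u n) f))\<^sup>2" for n
      by (simp add: u cmod_power2) (simp add: power2_eq_square algebra_simps)
    have "?F N = (p * (norm g)\<^sup>2 + q * inner f g + r * (norm f)\<^sup>2) -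
        (\<Sum>n<N. (p * (l n)\<^sup>2 + q * l n + r) * (cmod (cinner (u n) f))\<^sup>2)"
      unfolding norm_truncated_complement inner_truncated_complement Re
      by (simp add: u norm_mult power_mult_distrib sum_distrib_left sum.distrib algebra_simps)
    moreover have "(\<Sum>n<N. (p * (l n)\<^sup>2 + q * l n + r) * (cmod (cinner (u n) f))\<^sup>2) \<le> 0"
      by (intro sum_nonpos mult_nonpos_nonneg le) auto
    ultimately show ?thesis using ge by linarith
  qed
  moreover have "?F \<longlonglongrightarrow> p * (norm (complement g))\<^sup>2 + q * inner (complement f) (complement g)
    + r * (norm (complement f))\<^sup>2"
    by (intro tendsto_intros truncated_complement_tendsto)
  ultimately show ?thesis using LIMSEQ_le_const by blast
qed

end

section \<open>Self-adjoint extensions with prescribed eigenvectors\<close>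

lemma linear_operator_iff: "linear_operator A \<longleftrightarrow> clinear_on (dom A) (\<lambda>f. A \<bullet>\<bullet> f)"
  by (simp add: linear_operator_def clinear_on_def)

text \<open>Density leaves at most one candidate \<open>h\<close>, so the description in
  \<open>adjoint\<close> selects it.\<close>

lemma adjoint_eq_Some_iff:
  assumes "densely_defined A"
  shows "adjoint A g = Some h \<longleftrightarrow> (\<forall>f\<in>dom A. cinner g (A \<bullet>\<bullet> f) = cinner h f)"
proof -
  have unique: "h = h'" if "\<forall>f\<in>dom A. cinner g (A \<bullet>\<bullet> f) = cinner h f"
    "\<forall>f\<in>dom A. cinner g (A \<bullet>\<bullet> f) = cinner h' f" for h h'
    using assms that by (intro eq_if_cinner_eq_dense[of "dom A"]) (auto simp: densely_defined_def)
  show ?thesis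
  proof
    assume "adjoint A g = Some h"
    then obtain h' where h': "\<forall>f\<in>dom A. cinner g (A \<bullet>\<bullet> f) = cinner h' f"
      and "(THE h. \<forall>f\<in>dom A. cinner g (A \<bullet>\<bullet> f) = cinner h f) = h"
      by (auto simp: adjoint_def split: if_splits)
    with the_equality[of "\<lambda>h. \<forall>f\<in>dom A. cinner g (A \<bullet>\<bullet> f) = cinner h f", OF h'] unique
    show "\<forall>f\<in>dom A. cinner g (A \<bullet>\<bullet> f) = cinner h f" by metis
  next
    assume h: "\<forall>f\<in>dom A. cinner g (A \<bullet>\<bullet> f) = cinner h f"
    then have "(THE h. \<forall>f\<in>dom A. cinner g (A \<bullet>\<bullet> f) = cinner h f) = h"
      using unique by (intro the_equality) auto
    with h show "adjoint A g = Some h" by (auto simp: adjoint_def)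
  qed
qed

lemma ker_shift_adjoint:
  assumes "densely_defined A"
  shows "ker_shift (adjoint A) z = {u. \<forall>f\<in>dom A. cinner u (A \<bullet>\<bullet> f) = cnj z * cinner u f}"
proof -
  have "u \<in> ker_shift (adjoint A) z \<longleftrightarrow> adjoint A u = Some (z *\<^sub>C u)" for u
    by (auto simp: ker_shift_def)
  then show ?thesis
    by (auto simp: adjoint_eq_Some_iff[OF assms] cinner_scaleC_left)
qed

text \<open>With \<open>g = k + c *\<^sub>R f\<close> the form is a strictly negative multiple of
  the squared norm of \<open>f\<close> plus terms containing \<open>k\<close>, so \<open>k\<close>
  cannot be small compared with \<open>f\<close>.\<close>

lemma bounded_below_of_quadratic_form:
  fixes c p q r :: real
  assumes p: "p \<ge> 0" and neg: "p * c\<^sup>2 + q * c + r < 0"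
  obtains C where "C \<ge> 0"
    "\<And>f g :: 'a::real_inner. p * (norm g)\<^sup>2 + q * inner f g + r * (norm f)\<^sup>2 \<ge> 0 \<Longrightarrow>
       norm f \<le> C * norm (g - c *\<^sub>R f)"
proof -
  \<comment> \<open>\<open>\<epsilon>\<close> and \<open>d\<close> are the absolute values of the
    polynomial and its derivative at \<open>c\<close>. The summand \<open>\<epsilon>\<close> in the
    numerator of \<open>C\<close> ensures \<open>C \<ge> 1\<close>, hence
    \<open>norm k < norm f\<close> below.\<close>
  define \<epsilon> where "\<epsilon> = - (p * c\<^sup>2 + q * c + r)"
  define d where "d = \<bar>2 * p * c + q\<bar>"
  define C where "C = (d + p + \<epsilon>) / \<epsilon>"
  have \<epsilon>: "\<epsilon> > 0" and d: "d \<ge> 0" using neg by (auto simp: \<epsilon>_def d_def)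
  have C: "C \<ge> 1" using \<epsilon> d p by (simp add: C_def)
  have "norm f \<le> C * norm (g - c *\<^sub>R f)"
    if ge: "p * (norm g)\<^sup>2 + q * inner f g + r * (norm f)\<^sup>2 \<ge> 0" for f g :: 'a
  proof (rule ccontr)
    assume *: "\<not> ?thesis"
    define k where "k = g - c *\<^sub>R f"
    have less: "C * norm k < norm f" using * by (simp add: k_def)
    then have k_less: "norm k < norm f"
      using mult_right_mono[OF C norm_ge_zero[of k]] by linarith
    have g: "g = k + c *\<^sub>R f" by (simp add: k_def)
    have "\<epsilon> * (norm f)\<^sup>2 \<le> p * (norm k)\<^sup>2 + (2 * p * c + q) * inner f k"
      using ge unfolding g \<epsilon>_def power2_norm_eq_inner
      by (simp add: inner_add_left inner_add_right inner_commute algebra_simps power2_eq_square)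
    also have "(2 * p * c + q) * inner f k \<le> d * (norm f * norm k)"
    proof -
      have "(2 * p * c + q) * inner f k \<le> d * \<bar>inner f k\<bar>"
        by (metis abs_ge_self abs_mult d_def)
      also have "\<dots> \<le> d * (norm f * norm k)"
        using d Cauchy_Schwarz_ineq2 by (intro mult_left_mono) auto
      finally show ?thesis .
    qed
    also have "p * (norm k)\<^sup>2 \<le> p * (norm f * norm k)"
      using p k_less by (intro mult_left_mono) (auto simp: power2_eq_square intro: mult_right_mono)
    finally have "\<epsilon> * (norm f)\<^sup>2 \<le> (p + d) * norm k * norm f"
      by (simp add: algebra_simps)
    also have "\<dots> \<le> (\<epsilon> * C) * norm k * norm f"
      using \<epsilon> by (intro mult_right_mono) (auto simp: C_def)
    finally have "(\<epsilon> * norm f) * norm f \<le> (\<epsilon> * C * norm k) * norm f"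
      by (simp add: power2_eq_square)
    moreover have "norm f > 0" using k_less norm_ge_zero[of k] by linarith
    ultimately have "\<epsilon> * norm f \<le> \<epsilon> * (C * norm k)"
      by (simp only: mult_le_cancel_right) (auto simp: mult.assoc)
    with \<epsilon> less show False by simp
  qed
  with that[of C] C show thesis by simp
qed

text \<open>
  \<open>B\<close> inverts \<open>S - c\<close> compressed to the orthogonal complement of the \<open>u n\<close>. The operator \<open>T\<close> is
  the direct sum of \<open>c + B\<inverse>\<close> there and of the diagonal operator with eigenvalues \<open>l n\<close>.
\<close>

lemma (in orthonormal_sequence) self_adjoint_extension_with_eigenvectors:
  fixes S :: "'a operator" and l :: "nat \<Rightarrow> real" and c p q r :: real
  assumes S: "linear_operator S" "densely_defined S" "symmetric S"
    and u: "\<And>n f. f \<in> dom S \<Longrightarrow> cinner (u n) (S \<bullet>\<bullet> f) = l n * cinner (u n) f"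
    and p: "p \<ge> 0" and l: "\<And>n. p * (l n)\<^sup>2 + q * l n + r \<le> 0" and c: "p * c\<^sup>2 + q * c + r < 0"
    and form: "\<And>f. f \<in> dom S \<Longrightarrow>
       p * (norm (S \<bullet>\<bullet> f))\<^sup>2 + q * inner f (S \<bullet>\<bullet> f) + r * (norm f)\<^sup>2 \<ge> 0"
  obtains T where "self_adjoint T" "S \<subseteq>\<^sub>m T" "\<And>n. T (u n) = Some (l n *\<^sub>R u n)"
proof -
  let ?P = complement
  have P_diff: "?P (x - y) = ?P x - ?P y" for x y
    using complement_add[of "x - y" y] by simp
  have lin: "clinear_on (dom S) (\<lambda>f. S \<bullet>\<bullet> f)" using S(1) by (simp add: linear_operator_iff)
  have sub: "cvs.subspace (dom S)" using lin by (rule clinear_onD)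
  define X where "X f = ?P (S \<bullet>\<bullet> f - c *\<^sub>R f)" for f
  have X: "clinear_on (dom S) X"
    using sub by (auto simp: clinear_on_def X_def clinear_onD[OF lin] complement_add P_diff
        complement_scaleC complement_scaleR algebra_simps cvs.scale_right_diff_distrib
        cvs.scale_left_commute simp flip: scaleC_of_real)
  have Y: "clinear_on (dom S) ?P"
    using sub by (auto simp: clinear_on_def complement_add complement_scaleC)
  obtain C where C: "C \<ge> 0"
    "\<And>f g :: 'a. p * (norm g)\<^sup>2 + q * inner f g + r * (norm f)\<^sup>2 \<ge> 0 \<Longrightarrow>
       norm f \<le> C * norm (g - c *\<^sub>R f)"
    using bounded_below_of_quadratic_form[OF p c, where ?'a = 'a] by blast
  have bound: "norm (?P f) \<le> C * norm (X f)" if "f \<in> dom S" for f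
    unfolding X_def P_diff complement_scaleR
    by (intro C(2) quadratic_form_complement[of _ l] u l form that)
  \<comment> \<open>The \<open>u n\<close> contribute equally to both sides of the symmetry relation
    of \<open>S\<close>; subtracting them leaves symmetry of the compression.\<close>
  have PS: "cinner k (?P (S \<bullet>\<bullet> f)) = cinner (?P (S \<bullet>\<bullet> k)) f" if "f \<in> dom S" "k \<in> dom S" for f k
    using cinner_complement_shift[of "S \<bullet>\<bullet> f" l f "S \<bullet>\<bullet> k" k] u that S(3)
    by (simp add: symmetric_def complement_symmetric)
  have sym: "cinner (X f) (?P k) = cinner (?P f) (X k)" if "f \<in> dom S" "k \<in> dom S" for f k
    using PS[OF that(2) that(1)]
    by (simp add: X_def P_diff complement_scaleR complement_symmetric complement_complement
        cinner.diff_left cinner.diff_right cinner.scaleR_left cinner.scaleR_right)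
  obtain B0 where B0: "\<And>x y. cinner (B0 x) y = cinner x (B0 y)"
      "\<And>f. f \<in> dom S \<Longrightarrow> B0 (X f) = ?P f"
    using symmetric_extension[OF X Y bound C(1) sym] by blast
  \<comment> \<open>\<open>B0\<close> need not respect the complement; cutting it down on both sides
    keeps symmetry and its values on the vectors \<open>X f\<close>.\<close>
  define B where "B x = ?P (B0 (?P x))" for x
  have B: "cinner (B x) y = cinner x (B y)" for x y
    by (simp add: B_def B0 complement_symmetric)
  have B_add: "B (x + y) = B x + B y" for x y
    by (rule cinner_eqI) (simp add: B cinner.add_left)
  have B_scaleC: "B (z *\<^sub>C x) = z *\<^sub>C B x" for x z
    by (rule cinner_eqI) (simp add: B cinner_scaleC_left)
  have B_diff: "B (x - y) = B x - B y" for x y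
    using B_add[of "x - y" y] by simp
  have B_P: "B (?P x) = B x" and P_B: "?P (B x) = B x" and u_B: "cinner (u n) (B x) = 0" for x n
    by (simp_all add: B_def complement_complement cinner_u_complement)
  have B_u: "B (u n) = 0" for n
    using B_scaleC[of 0 0] by (metis B_P complement_u cvs.scale_zero_left)
  have B_S: "B (S \<bullet>\<bullet> f - c *\<^sub>R f) = ?P f" if "f \<in> dom S" for f
    using B0(2)[OF that] by (simp add: B_def X_def complement_complement)

  \<comment> \<open>The graph of \<open>T\<close>. The first condition is the equation for
    \<open>c + B\<inverse>\<close> solved for \<open>f\<close>, which avoids the inverse; the second
    prescribes the coefficients along the \<open>u n\<close>.\<close>
  define G where "G f g \<longleftrightarrow> ?P f = B (g - c *\<^sub>R f) \<and> (\<forall>n. cinner (u n) g = l n * cinner (u n) f)" for f g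
  have G_S: "G f (S \<bullet>\<bullet> f)" if "f \<in> dom S" for f
    using that by (simp add: G_def B_S u)
  \<comment> \<open>\<open>B\<close> is injective on the complement: its range contains
    \<open>?P f\<close> for all \<open>f\<close> in the dense domain of \<open>S\<close>, and
    \<open>B\<close> is symmetric.\<close>
  have G_unique: "g = g'" if "G f g" "G f g'" for f g g'
  proof -
    have "B (g - c *\<^sub>R f) = B (g' - c *\<^sub>R f)" using that by (simp add: G_def)
    then have "B (g - g') = 0" by (simp add: B_diff)
    moreover have "?P (g - g') = g - g'"
      using that by (intro complement_id) (simp add: G_def cinner.diff_right)
    ultimately have "cinner (g - g') f = cinner 0 f" if "f \<in> dom S" for f
      by (metis B B_S cinner.zero_left complement_symmetric that)
    then have "g - g' = 0"
      using S(2) by (intro eq_if_cinner_eq_dense[of "dom S"]) (auto simp: densely_defined_def)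
    then show ?thesis by simp
  qed
  define T where "T f = (if \<exists>g. G f g then Some (THE g. G f g) else None)" for f
  have T_iff: "T f = Some g \<longleftrightarrow> G f g" for f g
  proof -
    have "(THE g. G f g) = g'" if "G f g'" for g'
      using that G_unique by blast
    then show ?thesis by (auto simp: T_def)
  qed
  have dom_T: "dom T = {f. \<exists>g. G f g}" by (auto simp: T_iff)
  have T_G: "G f (T \<bullet>\<bullet> f)" if "f \<in> dom T" for f
    using that T_iff by (metis domD option.sel)
  have S_T: "S \<subseteq>\<^sub>m T"
    unfolding map_le_def using G_S T_iff by (metis domD option.sel)
  have T_u: "T (u n) = Some (l n *\<^sub>R u n)" for n
    unfolding T_iff G_def
  proof (intro conjI allI)
    have "l n *\<^sub>R u n - c *\<^sub>R u n = of_real (l n - c) *\<^sub>C u n"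
      by (simp only: scaleC_of_real scaleR_left_diff_distrib)
    then show "?P (u n) = B (l n *\<^sub>R u n - c *\<^sub>R u n)"
      by (simp only: B_scaleC B_u complement_u cvs.scale_zero_right)
    show "cinner (u m) (l n *\<^sub>R u n) = l m * cinner (u m) (u n)" for m
      by (simp add: cinner.scaleR_right orthonormal scaleR_conv_of_real)
  qed
  have G_add: "G (f + f') (g + g')" if "G f g" "G f' g'" for f f' g g'
    using that by (auto simp: G_def complement_add B_add B_diff cinner.add_right algebra_simps)
  have G_scaleC: "G (z *\<^sub>C f) (z *\<^sub>C g)" if "G f g" for f g z
  proof -
    have "z *\<^sub>C g - c *\<^sub>R (z *\<^sub>C f) = z *\<^sub>C (g - c *\<^sub>R f)"
      by (simp add: cvs.scale_right_diff_distrib cvs.scale_left_commute flip: scaleC_of_real)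
    then show ?thesis
      using that by (auto simp: G_def complement_scaleC B_scaleC cinner_scaleC_right)
  qed
  have G_0: "G 0 0"
    using G_scaleC[of _ _ 0] T_u[of 0] T_iff by fastforce
  have "linear_operator T"
    unfolding linear_operator_def
  proof (intro conjI ballI allI)
    show "cvs.subspace (dom T)"
      unfolding cvs.subspace_def dom_T using G_0 G_add G_scaleC by blast
    show "T \<bullet>\<bullet> (f + g) = T \<bullet>\<bullet> f + T \<bullet>\<bullet> g" if "f \<in> dom T" "g \<in> dom T" for f g
      using G_add[OF T_G[OF that(1)] T_G[OF that(2)]] by (simp flip: T_iff)
    show "T \<bullet>\<bullet> (z *\<^sub>C f) = z *\<^sub>C (T \<bullet>\<bullet> f)" if "f \<in> dom T" for f z
      using G_scaleC[OF T_G[OF that]] by (simp flip: T_iff)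
  qed
  moreover have dense: "densely_defined T"
    using S(2) closure_mono[OF map_le_implies_dom_le[OF S_T]] by (auto simp: densely_defined_def)
  moreover have "adjoint T = T"
  proof -
    \<comment> \<open>Symmetry of \<open>B\<close> handles the complement, and the shift identity
      the span of the \<open>u n\<close>.\<close>
    have sym_G: "cinner k g = cinner h f" if "G f g" "G k h" for f g h k
    proof -
      have "cinner k (?P g) - c * cinner k (?P f) = cinner (?P k) (g - c *\<^sub>R f)"
        by (simp add: complement_symmetric P_diff complement_scaleR cinner.diff_right
            cinner.scaleR_right scaleR_conv_of_real)
      also have "\<dots> = cinner (h - c *\<^sub>R k) (?P f)"
        using that by (simp add: G_def B)
      also have "\<dots> = cinner h (?P f) - c * cinner k (?P f)"
        by (simp add: cinner.diff_left cinner.scaleR_left scaleR_conv_of_real)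
      finally show ?thesis
        using that cinner_complement_shift[of g l f h k] by (simp add: G_def)
    qed
    have "(\<forall>f\<in>dom T. cinner k (T \<bullet>\<bullet> f) = cinner h f) \<longleftrightarrow> G k h" for k h
    proof
      assume *: "\<forall>f\<in>dom T. cinner k (T \<bullet>\<bullet> f) = cinner h f"
      have eq: "cinner k g = cinner h f" if "G f g" for f g
        using * that by (metis T_iff domI option.sel)
      have k_u: "cinner k (l n *\<^sub>R u n) = cinner h (u n)" for n
        using eq T_u T_iff by blast
      have "cinner (u n) h = l n * cinner (u n) k" for n
        using arg_cong[OF k_u[of n], of cnj]
        by (simp add: cinner.scaleR_right scaleR_conv_of_real flip: cinner_commute)
      moreover have "?P k = B (h - c *\<^sub>R k)"
      proof (rule cinner_eqI)
        fix g
        \<comment> \<open>All vectors \<open>B g\<close> lie in the domain of \<open>T\<close>; as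
          \<open>g\<close> is arbitrary, testing against them determines the part of
          \<open>k\<close> in the complement.\<close>
        have "G (B g) (?P g + c *\<^sub>R B g)"
          by (simp add: G_def P_B B_P cinner.add_right cinner.scaleR_right cinner_u_complement u_B)
        from eq[OF this] show "cinner (?P k) g = cinner (B (h - c *\<^sub>R k)) g"
          by (simp add: B complement_symmetric cinner.add_right cinner.scaleR_right
              cinner.diff_left cinner.scaleR_left algebra_simps)
      qed
      ultimately show "G k h" by (simp add: G_def)
    qed (use sym_G T_G in blast)
    then show ?thesis
      using adjoint_eq_Some_iff[OF dense] T_iff by (intro ext) (metis not_None_eq)
  qed
  ultimately have "self_adjoint T" by (simp add: self_adjoint_def)
  with S_T T_u that show thesis by blast
qed

section \<open>Deficiency spaces\<close>

lemma cvs_subspace_orthogonal: "cvs.subspace {x. cinner x v = 0}" for v :: "'a::complex_hilbert"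
  unfolding cvs.subspace_def by (auto simp: cinner.add_left cinner_scaleC_left cinner.zero_left)

text \<open>Each condition lowers the dimension by at most one: given \<open>v0\<close> violating
  it, every vector is a multiple of \<open>v0\<close> plus a vector satisfying it.\<close>

lemma infinite_dimensional_orthogonal:
  fixes V :: "'a::complex_hilbert set"
  assumes "finite F" "cvs.subspace V" "infinite_dimensional V"
  shows "infinite_dimensional {v \<in> V. \<forall>w\<in>F. cinner w v = 0}"
  using assms(1)
proof induction
  case empty
  then show ?case using assms(3) by simp
next
  case (insert w F)
  let ?V = "{v \<in> V. \<forall>w\<in>F. cinner w v = 0}"
  have V: "cvs.subspace ?V"
    using assms(2) unfolding cvs.subspace_def
    by (auto simp: cinner.add_right cinner_scaleC_right cinner.zero_right)
  show ?case
  proof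
    assume "finite_dimensional {v \<in> V. \<forall>x\<in>insert w F. cinner x v = 0}"
    then obtain B where B: "finite B" "\<And>v. v \<in> ?V \<Longrightarrow> cinner w v = 0 \<Longrightarrow> v \<in> cvs.span B"
      unfolding finite_dimensional_def by auto
    obtain v0 where v0: "v0 \<in> ?V" "cinner w v0 \<noteq> 0"
      using insert.IH B unfolding finite_dimensional_def by blast
    have "?V \<subseteq> cvs.span (insert v0 B)"
    proof
      fix v assume v: "v \<in> ?V"
      define t where "t = cinner w v / cinner w v0"
      have "v - t *\<^sub>C v0 \<in> cvs.span B"
      proof (rule B)
        show "v - t *\<^sub>C v0 \<in> ?V"
          using V v v0(1) cvs.subspace_diff cvs.subspace_scale by blast
        show "cinner w (v - t *\<^sub>C v0) = 0"
          using v0(2) by (simp add: t_def cinner.diff_right cinner_scaleC_right)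
      qed
      then show "v \<in> cvs.span (insert v0 B)" using cvs.span_breakdown_eq by blast
    qed
    then show False
      using insert.IH B(1) unfolding finite_dimensional_def by (meson finite_insert)
  qed
qed

lemma obtain_unit_vector_orthogonal:
  fixes V :: "'a::complex_hilbert set"
  assumes "finite F" "cvs.subspace V" "infinite_dimensional V"
  obtains v where "v \<in> V" "norm v = 1" "\<And>w. w \<in> F \<Longrightarrow> cinner w v = 0"
proof -
  have "\<not> {v \<in> V. \<forall>w\<in>F. cinner w v = 0} \<subseteq> {0}"
    using infinite_dimensional_orthogonal[OF assms] unfolding finite_dimensional_def
    by (meson cvs.span_superset finite.emptyI finite_insert subset_trans)
  then obtain v where v: "v \<in> V" "v \<noteq> 0" "\<And>w. w \<in> F \<Longrightarrow> cinner w v = 0" by blast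
  show thesis
  proof (rule that)
    show "of_real (1 / norm v) *\<^sub>C v \<in> V" using assms(2) v(1) by (rule cvs.subspace_scale)
    show "norm (of_real (1 / norm v) *\<^sub>C v) = 1" using v(2) by (simp add: norm_scaleC norm_divide)
    show "cinner w (of_real (1 / norm v) *\<^sub>C v) = 0" if "w \<in> F" for w
      using v(3)[OF that] by (simp add: cinner_scaleC_right)
  qed
qed

text \<open>For densely defined \<open>S\<close> this is \<open>ker_shift (adjoint S) z\<close>, by
  \<open>ker_shift_adjoint\<close>. The conjugate arises because \<open>z\<close> multiplies the
  antilinear slot.\<close>

definition deficiency_space :: "'a::complex_hilbert operator \<Rightarrow> complex \<Rightarrow> 'a set" where
  "deficiency_space S z = {u. \<forall>f\<in>dom S. cinner u (S \<bullet>\<bullet> f) = cnj z * cinner u f}"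

lemma cvs_subspace_deficiency_space: "cvs.subspace (deficiency_space S z)"
  unfolding cvs.subspace_def deficiency_space_def
  by (auto simp: cinner.add_left cinner_scaleC_left cinner.zero_left algebra_simps)

text \<open>Otherwise some unit vector \<open>v\<close> of the space at \<open>z\<close> is
  orthogonal to the space at \<open>w\<close>, hence lies in the closed range of
  \<open>S - cnj w\<close>. But its pairing with that range is bounded with a constant below
  1.\<close>

lemma infinite_deficiency_step:
  assumes S: "linear_operator S"
    and bound: "\<And>f. f \<in> dom S \<Longrightarrow> k * norm f \<le> norm (S \<bullet>\<bullet> f - cnj w *\<^sub>C f)"
    and k: "cmod (z - w) < k"
    and inf: "infinite_dimensional (deficiency_space S z)"
  shows "infinite_dimensional (deficiency_space S w)"
proof
  assume "finite_dimensional (deficiency_space S w)"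
  then obtain F where F: "finite F" "deficiency_space S w \<subseteq> cvs.span F"
    unfolding finite_dimensional_def by blast
  obtain v where v: "v \<in> deficiency_space S z" "norm v = 1" "\<And>x. x \<in> F \<Longrightarrow> cinner x v = 0"
    using obtain_unit_vector_orthogonal[OF F(1) cvs_subspace_deficiency_space inf] by blast
  have orth: "cinner x v = 0" if "x \<in> deficiency_space S w" for x
    using cvs.span_minimal[OF _ cvs_subspace_orthogonal[of v], of F] v(3) F(2) that by blast
  define X where "X f = S \<bullet>\<bullet> f - cnj w *\<^sub>C f" for f
  have X: "clinear_on (dom S) X"
    using S by (auto simp: linear_operator_iff clinear_on_def X_def scaleC_add_right
        cvs.scale_right_diff_distrib mult.commute)
  \<comment> \<open>\<open>e\<close> is the projection of \<open>v\<close> onto the closed range;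
    \<open>v - e\<close> lies in the space at \<open>w\<close>, so it is orthogonal to both
    \<open>v\<close> and \<open>e\<close>, and \<open>v = e\<close>.\<close>
  obtain e where e: "e \<in> closure (X ` dom S)" "\<And>f. f \<in> dom S \<Longrightarrow> cinner e (X f) = cinner v (X f)"
    using riesz[OF X clinear_on_cinner[OF X, of v], of "norm v"] cmod_cinner_le by blast
  have "v - e \<in> deficiency_space S w"
    using e(2) by (auto simp: deficiency_space_def X_def cinner.diff_left cinner.diff_right
        cinner_scaleC_right algebra_simps)
  then have "cinner (v - e) v = 0" by (rule orth)
  moreover have "cinner (v - e) e = cinner 0 e"
  proof (rule cinner_eq_closure[OF _ e(1)])
    fix x assume "x \<in> X ` dom S"
    then obtain f where "f \<in> dom S" "x = X f" by blast
    then show "cinner (v - e) x = cinner 0 x" by (simp add: cinner.diff_left e(2) cinner.zero_left)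
  qed
  ultimately have "cinner (v - e) (v - e) = 0"
    by (simp add: cinner.diff_right cinner.zero_left)
  then have v_closure: "v \<in> closure (X ` dom S)" using e(1) by (simp add: cinner_self)
  define t where "t = cmod (z - w) / k"
  have k0: "k > 0" using k norm_ge_zero[of "z - w"] by linarith
  have "cmod (cinner v (X f)) \<le> t * norm (X f)" if f: "f \<in> dom S" for f
  proof -
    have "cinner v (X f) = cnj (z - w) * cinner v f"
      using v(1) f
      by (simp add: deficiency_space_def X_def cinner.diff_right cinner_scaleC_right algebra_simps)
    then have "cmod (cinner v (X f)) \<le> cmod (z - w) * norm f"
      using cmod_cinner_le[of v f] v(2)
      by (metis complex_mod_cnj mult_1 mult_left_mono norm_ge_zero norm_mult)
    also have "\<dots> = t * (k * norm f)" using k0 by (simp add: t_def)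
    also have "\<dots> \<le> t * norm (X f)"
      using bound[OF f] k0 by (intro mult_left_mono) (auto simp: t_def X_def)
    finally show ?thesis .
  qed
  then have "X ` dom S \<subseteq> {x. cmod (cinner v x) \<le> t * norm x}" by auto
  moreover have "closed {x. cmod (cinner v x) \<le> t * norm x}"
    by (intro closed_Collect_le cinner.continuous_on continuous_intros)
  ultimately have "cmod (cinner v v) \<le> t * norm v"
    using closure_minimal v_closure by blast
  then show False using v(2) k k0 by (simp add: cinner_self t_def field_simps)
qed

text \<open>This unifies the two shapes of a gap: the semibounded case gives \<open>x - b\<close>,
  and squaring the norm inequality of a finite gap gives \<open>(x - a') * (x - b)\<close>.\<close>

lemma has_gap_quadratic_form:
  fixes S :: "'a::complex_hilbert operator"
  assumes gap: "has_gap S a b"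
  obtains p q r :: real where "p \<ge> 0" "\<And>x. x \<in> gap_interval a b \<Longrightarrow> p * x\<^sup>2 + q * x + r < 0"
    "\<And>f. f \<in> dom S \<Longrightarrow> p * (norm (S \<bullet>\<bullet> f))\<^sup>2 + q * inner f (S \<bullet>\<bullet> f) + r * (norm f)\<^sup>2 \<ge> 0"
proof (cases a)
  case PInf
  then show thesis using gap by (simp add: has_gap_def)
next
  case MInf
  show thesis
  proof (rule that[of 0 1 "- b"])
    show "0 * (norm (S \<bullet>\<bullet> f))\<^sup>2 + 1 * inner f (S \<bullet>\<bullet> f) + - b * (norm f)\<^sup>2 \<ge> 0" if "f \<in> dom S" for f
      using gap MInf that by (simp add: has_gap_def inner_eq_Re_cinner)
  qed (auto simp: gap_interval_def)
next
  case (real a')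
  show thesis
  proof (rule that[of 1 "- (a' + b)" "a' * b"])
    show "1 * x\<^sup>2 + - (a' + b) * x + a' * b < 0" if "x \<in> gap_interval a b" for x
    proof -
      have "(x - a') * (x - b) < 0"
        using that real by (intro mult_pos_neg) (auto simp: gap_interval_def)
      then show ?thesis by (simp add: algebra_simps power2_eq_square)
    qed
    fix f assume f: "f \<in> dom S"
    have "b - a' > 0" using gap real by (simp add: has_gap_def)
    then have "((b - a') / 2 * norm f)\<^sup>2 \<le> (norm (S \<bullet>\<bullet> f - ((a' + b) / 2) *\<^sub>R f))\<^sup>2"
      using gap real f by (intro power_mono) (auto simp: has_gap_def)
    also have "\<dots> = (norm (S \<bullet>\<bullet> f))\<^sup>2 - (a' + b) * inner f (S \<bullet>\<bullet> f) + ((a' + b) / 2)\<^sup>2 * (norm f)\<^sup>2"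
      unfolding power2_norm_eq_inner
      by (simp add: inner_diff_left inner_diff_right inner_commute power2_eq_square)
    finally show "1 * (norm (S \<bullet>\<bullet> f))\<^sup>2 + - (a' + b) * inner f (S \<bullet>\<bullet> f) + a' * b * (norm f)\<^sup>2 \<ge> 0"
      by (simp add: power_mult_distrib power2_eq_square field_simps)
  qed simp
qed

text \<open>Since \<open>cinner f (S \<bullet>\<bullet> f)\<close> is real, only \<open>z\<close>
  contributes to the imaginary part of the form of \<open>S - z\<close>; Cauchy-Schwarz bounds
  it.\<close>

lemma symmetric_bounded_below_nonreal:
  assumes "symmetric S" "f \<in> dom S"
  shows "\<bar>Im z\<bar> * norm f \<le> norm (S \<bullet>\<bullet> f - z *\<^sub>C f)"
proof (cases "f = 0")
  case False
  have "cnj (cinner f (S \<bullet>\<bullet> f)) = cinner f (S \<bullet>\<bullet> f)"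
    using assms by (metis cinner_commute symmetric_def)
  then have "Im (cinner f (S \<bullet>\<bullet> f)) = 0"
    using Reals_cnj_iff complex_is_Real_iff by blast
  then have "Im (cinner f (S \<bullet>\<bullet> f - z *\<^sub>C f)) = - Im z * (norm f)\<^sup>2"
    by (simp add: cinner.diff_right cinner_scaleC_right cinner_self flip: of_real_power)
  then have "\<bar>Im z\<bar> * (norm f)\<^sup>2 = \<bar>Im (cinner f (S \<bullet>\<bullet> f - z *\<^sub>C f))\<bar>"
    by (simp add: abs_mult)
  also have "\<dots> \<le> norm f * norm (S \<bullet>\<bullet> f - z *\<^sub>C f)"
    using abs_Im_le_cmod cmod_cinner_le order_trans by blast
  finally have "norm f * (\<bar>Im z\<bar> * norm f) \<le> norm f * norm (S \<bullet>\<bullet> f - z *\<^sub>C f)"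
    by (simp add: power2_eq_square algebra_simps)
  then show ?thesis using False by simp
qed simp

text \<open>Any gap point \<open>c\<close> is a centre: a segment from \<open>c\<close> to a nonreal
  point meets the real line only in \<open>c\<close>, and one to a gap point stays in the gap. The
  purpose is connectedness.\<close>

lemma starlike_nonreal_or_gap:
  assumes "a < ereal b"
  shows "starlike ((- \<real>) \<union> complex_of_real ` gap_interval a b)" (is "starlike ?\<Omega>")
proof -
  obtain c where c: "a < ereal c" "c < b" using ereal_dense2[OF assms] by auto
  have "closed_segment (of_real c) z \<subseteq> ?\<Omega>" if "z \<in> ?\<Omega>" for z
  proof
    fix y assume "y \<in> closed_segment (complex_of_real c) z"
    then obtain t where t: "0 \<le> t" "t \<le> 1" "y = (1 - t) *\<^sub>R of_real c + t *\<^sub>R z"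
      by (auto simp: in_segment)
    show "y \<in> ?\<Omega>"
    proof (cases "t = 0 \<or> z \<in> \<real>")
      case False
      then have "Im y \<noteq> 0" by (simp add: t complex_is_Real_iff)
      then show ?thesis by (simp add: complex_is_Real_iff)
    next
      case True
      then obtain x where x: "a < ereal x" "x < b" "y = of_real ((1 - t) * c + t * x)"
      proof
        assume "t = 0"
        then show thesis using that[of c] c t by simp
      next
        assume "z \<in> \<real>"
        then obtain x where "z = of_real x" "a < ereal x" "x < b"
          using \<open>z \<in> ?\<Omega>\<close> by (auto simp: gap_interval_def)
        then show thesis using that[of x] t by (simp add: scaleR_conv_of_real)
      qed
      have "min c x \<le> (1 - t) * c + t * x \<and> (1 - t) * c + t * x \<le> max c x"
        using t(1,2) convex_bound_le[of c "max c x" x "1 - t" t]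
          convex_bound_le[of "- c" "- min c x" "- x" "1 - t" t] by simp
      moreover have "a < ereal (min c x)" "max c x < b" using c x by (auto simp: min_def)
      ultimately have "(1 - t) * c + t * x \<in> gap_interval a b"
        by (auto simp: gap_interval_def intro: less_le_trans simp del: ereal_min)
      then show ?thesis using x(3) by blast
    qed
  qed
  moreover have "complex_of_real c \<in> ?\<Omega>" using c by (auto simp: gap_interval_def)
  ultimately show ?thesis unfolding starlike_def by blast
qed

lemma infinite_dimensional_deficiency_space:
  fixes S :: "'a::complex_hilbert operator"
  assumes S: "linear_operator S" "densely_defined S" "symmetric S" and gap: "has_gap S a b"
    and inf: "infinite_deficiency_index S a b" and x: "x \<in> gap_interval a b"
  shows "infinite_dimensional (deficiency_space S (complex_of_real x))"
proof -
  define \<Omega> where "\<Omega> = (- \<real>) \<union> complex_of_real ` gap_interval a b"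
  have below: "\<exists>k>0. \<forall>f\<in>dom S. k * norm f \<le> norm (S \<bullet>\<bullet> f - cnj z *\<^sub>C f)" if z: "z \<in> \<Omega>" for z
  proof (cases "z \<in> \<real>")
    case False
    then show ?thesis
      using symmetric_bounded_below_nonreal[OF S(3), of _ "cnj z"]
      by (intro exI[of _ "\<bar>Im z\<bar>"]) (auto simp: complex_is_Real_iff)
  next
    case True
    then obtain c where c: "z = of_real c" "c \<in> gap_interval a b"
      using z by (auto simp: \<Omega>_def)
    obtain p q r where pqr: "p \<ge> 0" "p * c\<^sup>2 + q * c + r < 0"
      "\<And>f. f \<in> dom S \<Longrightarrow> p * (norm (S \<bullet>\<bullet> f))\<^sup>2 + q * inner f (S \<bullet>\<bullet> f) + r * (norm f)\<^sup>2 \<ge> 0"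
      using has_gap_quadratic_form[OF gap] c(2) by metis
    obtain C where C: "C \<ge> 0" "\<And>f. f \<in> dom S \<Longrightarrow> norm f \<le> C * norm (S \<bullet>\<bullet> f - c *\<^sub>R f)"
      using bounded_below_of_quadratic_form[OF pqr(1,2), where ?'a = 'a] pqr(3) by metis
    \<comment> \<open>\<open>C + 1\<close> keeps the denominator positive when
      \<open>C = 0\<close>.\<close>
    have "1 / (C + 1) * norm f \<le> norm (S \<bullet>\<bullet> f - c *\<^sub>R f)" if "f \<in> dom S" for f
    proof -
      have "norm f \<le> (C + 1) * norm (S \<bullet>\<bullet> f - c *\<^sub>R f)"
        using C(2)[OF that] by (simp add: distrib_right add_increasing2)
      then show ?thesis using C(1) by (simp add: divide_simps mult.commute)
    qed
    then show ?thesis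
      using C(1) by (intro exI[of _ "1 / (C + 1)"]) (auto simp: c scaleC_of_real)
  qed
  obtain z where z: "z \<in> \<Omega>" "infinite_dimensional (deficiency_space S z)"
    using inf by (auto simp: infinite_deficiency_index_def ker_shift_adjoint[OF S(2)] \<Omega>_def
        deficiency_space_def)
  show ?thesis
  proof (rule connected_induction_simple[where S = \<Omega> and a = z])
    show "connected \<Omega>"
      using gap starlike_imp_connected[OF starlike_nonreal_or_gap] by (simp add: \<Omega>_def has_gap_def)
    show "complex_of_real x \<in> \<Omega>" using x by (simp add: \<Omega>_def)
    fix w assume "w \<in> \<Omega>"
    then obtain k where k: "k > 0" "\<And>f. f \<in> dom S \<Longrightarrow> k * norm f \<le> norm (S \<bullet>\<bullet> f - cnj w *\<^sub>C f)"
      using below by metis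
    \<comment> \<open>The step is made from \<open>x\<close> to the centre \<open>w\<close>, then
      from \<open>w\<close> to \<open>y\<close>. The bound \<open>k\<close> at \<open>w\<close>
      leaves \<open>k / 2\<close> at \<open>y\<close>, which still exceeds the distance from
      \<open>w\<close> to \<open>y\<close>.\<close>
    have "infinite_dimensional (deficiency_space S y)"
      if "infinite_dimensional (deficiency_space S x)" "x \<in> ball w (k / 2)" "y \<in> ball w (k / 2)" for x y
    proof -
      have less: "cmod (x - w) < k / 2" "cmod (w - y) < k / 2"
        using that by (auto simp: dist_norm norm_minus_commute)
      have "infinite_dimensional (deficiency_space S w)"
        by (rule infinite_deficiency_step[OF S(1) k(2) _ that(1)]) (use less k(1) in auto)
      moreover have "k / 2 * norm f \<le> norm (S \<bullet>\<bullet> f - cnj y *\<^sub>C f)" if "f \<in> dom S" for f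
      proof -
        have "S \<bullet>\<bullet> f - cnj w *\<^sub>C f = (S \<bullet>\<bullet> f - cnj y *\<^sub>C f) - cnj (w - y) *\<^sub>C f"
          by (simp add: cvs.scale_left_diff_distrib)
        then have "norm (S \<bullet>\<bullet> f - cnj w *\<^sub>C f) \<le> norm (S \<bullet>\<bullet> f - cnj y *\<^sub>C f) + cmod (w - y) * norm f"
          by (metis complex_mod_cnj norm_scaleC norm_triangle_ineq4)
        moreover have "cmod (w - y) * norm f \<le> k / 2 * norm f"
          using less by (intro mult_right_mono) auto
        ultimately show ?thesis using k(2)[OF that] by (simp add: field_simps)
      qed
      ultimately show ?thesis using less(2) infinite_deficiency_step[OF S(1)] by blast
    qed
    then show "\<exists>T. openin (top_of_set \<Omega>) T \<and> w \<in> T \<and>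
        (\<forall>x\<in>T. \<forall>y\<in>T. infinite_dimensional (deficiency_space S x) \<longrightarrow>
           infinite_dimensional (deficiency_space S y))"
      using k(1) \<open>w \<in> \<Omega>\<close>
      by (intro exI[of _ "\<Omega> \<inter> ball w (k / 2)"]) (auto simp: openin_open_Int)
  qed (use z in auto)
qed

section \<open>The essential spectrum\<close>

text \<open>Recursive choice: at stage \<open>n\<close> only the finitely many earlier vectors have
  to be avoided.\<close>

lemma exists_orthonormal_sequence:
  fixes V :: "nat \<Rightarrow> 'a::complex_hilbert set"
  assumes "\<And>n. cvs.subspace (V n)" "\<And>n. infinite_dimensional (V n)"
  obtains u where "orthonormal_sequence u" "\<And>n. u n \<in> V n"
proof -
  have "\<exists>u. \<forall>n. u n \<in> V n \<and> norm (u n) = 1 \<and> (\<forall>m<n. cinner (u m) (u n) = 0)"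
  proof (rule dependent_wellorder_choice)
    fix n and u :: "nat \<Rightarrow> 'a"
    show "\<exists>v. v \<in> V n \<and> norm v = 1 \<and> (\<forall>m<n. cinner (u m) v = 0)"
      using obtain_unit_vector_orthogonal[of "u ` {..<n}" "V n"] assms
      by (metis (no_types, lifting) finite_imageI finite_lessThan imageI lessThan_iff)
  qed auto
  then obtain u where u: "\<And>n. u n \<in> V n" "\<And>n. norm (u n) = 1" "\<And>m n. m < n \<Longrightarrow> cinner (u m) (u n) = 0"
    by blast
  have "orthonormal_sequence u"
  proof
    show "cinner (u m) (u n) = (if m = n then 1 else 0)" for m n
      using u(3)[of m n] u(3)[of n m] cinner_commute[of "u m" "u n"]
      by (cases m n rule: linorder_cases) (auto simp: cinner_self u(2))
  qed
  with u(1) that show thesis by blast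
qed

text \<open>A bounded inverse of \<open>T - x\<close>, tested on the unit eigenvectors, would keep
  all eigenvalues a fixed distance away from \<open>x\<close>.\<close>

lemma closure_eigenvalues_subset_spectrum:
  fixes l :: "nat \<Rightarrow> real" and u :: "nat \<Rightarrow> 'a::complex_hilbert"
  assumes T: "\<And>n. T (u n) = Some (l n *\<^sub>R u n)" and u: "\<And>n. norm (u n) = 1"
    and x: "x \<in> closure (range l)"
  shows "complex_of_real x \<in> spectrum T"
proof (rule ccontr)
  assume "complex_of_real x \<notin> spectrum T"
  then obtain C where C: "\<And>f. f \<in> dom T \<Longrightarrow> norm f \<le> C * norm (T \<bullet>\<bullet> f - complex_of_real x *\<^sub>C f)"
    by (auto simp: spectrum_def resolvent_set_def)
  have ge: "1 \<le> C * \<bar>l n - x\<bar>" for n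
    using C[of "u n"] u[of n] T[of n]
    by (auto simp: scaleC_of_real dom_def simp flip: scaleR_left_diff_distrib)
  obtain n where "\<bar>l n - x\<bar> < 1 / (\<bar>C\<bar> + 1)"
    using x[unfolded closure_approachable, rule_format, of "1 / (\<bar>C\<bar> + 1)"]
    by (auto simp: dist_real_def add_nonneg_pos)
  then have "(\<bar>C\<bar> + 1) * \<bar>l n - x\<bar> < 1" by (simp add: field_simps)
  moreover have "C * \<bar>l n - x\<bar> \<le> (\<bar>C\<bar> + 1) * \<bar>l n - x\<bar>"
    by (intro mult_right_mono) auto
  ultimately show False using ge[of n] by linarith
qed

text \<open>Eigenvalues other than \<open>x\<close> accumulate at \<open>x\<close>, so it is not
  isolated in the spectrum and cannot be discrete, whatever its kernel.\<close>

lemma dense_eigenvalues_essential_spectrum: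
  fixes l :: "nat \<Rightarrow> real" and u :: "nat \<Rightarrow> 'a::complex_hilbert"
  assumes T: "\<And>n. T (u n) = Some (l n *\<^sub>R u n)" and u: "\<And>n. norm (u n) = 1"
    and x: "x islimpt range l"
  shows "complex_of_real x \<in> essential_spectrum T"
proof -
  have spec: "complex_of_real y \<in> spectrum T" if "y \<in> closure (range l)" for y
    by (rule closure_eigenvalues_subset_spectrum[OF T u that])
  have "\<not> complex_of_real x isolated_in spectrum T"
  proof
    assume "complex_of_real x isolated_in spectrum T"
    then obtain U where U: "open U" "U \<inter> spectrum T = {complex_of_real x}"
      by (auto simp: isolated_in_def)
    have V: "open (complex_of_real -` U)"
      using U(1) by (intro open_vimage continuous_intros)
    have "x \<in> complex_of_real -` U" using U(2) by blast
    then obtain y where y: "y \<in> range l" "y \<in> complex_of_real -` U" "y \<noteq> x"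
      by (rule islimptE[OF x _ V])
    have "complex_of_real y \<in> spectrum T" using spec y(1) closure_subset by blast
    with y(2) U(2) have "complex_of_real y = complex_of_real x" by blast
    with y(3) show False by simp
  qed
  moreover have "complex_of_real x \<in> spectrum T"
    using spec x by (simp add: closure_def)
  ultimately show ?thesis by (simp add: essential_spectrum_def discrete_spectrum_def)
qed

section \<open>Rational points of the gap and the final construction\<close>

lemma open_gap_interval: "open (gap_interval a b)"
proof -
  have "gap_interval a b = {x. a < ereal x} \<inter> {..<b}" by (auto simp: gap_interval_def)
  moreover have "open {x. a < ereal x}" by (intro open_Collect_less continuous_intros)
  ultimately show ?thesis using open_Int open_lessThan by metis
qed

lemma islimpt_rationals_open:
  fixes U :: "real set"
  assumes "open U" "x \<in> closure U"
  shows "x islimpt (\<rat> \<inter> U)"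
  unfolding islimpt_def
proof (intro allI impI)
  fix W assume W: "x \<in> W" "open W"
  define V where "V = W \<inter> U"
  have "W \<inter> closure U \<noteq> {}" using assms(2) W(1) by blast
  then have V: "open V" "V \<noteq> {}"
    using assms(1) W(2) open_Int_closure_eq_empty[OF W(2), of U] by (simp_all add: V_def open_Int)
  \<comment> \<open>An open subset of the line is not a singleton, so \<open>V\<close> contains a
    ball that misses \<open>x\<close>, and that ball contains a rational.\<close>
  then have "V \<noteq> {x}" using not_open_singleton by metis
  then obtain y where "y \<in> V - {x}" using V(2) by blast
  moreover have "open (V - {x})" using V(1) by (simp add: open_delete)
  ultimately obtain d where d: "d > 0" "ball y d \<subseteq> V - {x}" using open_contains_ball by meson
  obtain t where "t \<in> \<rat>" "y < t" "t < y + d" using Rats_dense_in_real[of y "y + d"] d(1) by auto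
  then have "t \<in> ball y d" by (simp add: dist_real_def)
  then show "\<exists>t\<in>\<rat> \<inter> U. t \<in> W \<and> t \<noteq> x" using \<open>t \<in> \<rat>\<close> d(2) by (auto simp: V_def)
qed

theorem corollary3p6:
  fixes S :: "'a::complex_hilbert operator"
    and a :: ereal and b :: real and K :: "real set"
  assumes "infinite_dimensional (UNIV :: 'a set)"
    and "linear_operator S" and "densely_defined S" and "symmetric S"
    and "has_gap S a b"
    and "infinite_deficiency_index S a b"
    and "closed K" and "K \<subseteq> closure (gap_interval a b)"
  shows "\<exists>T. self_adjoint T \<and> S \<subseteq>\<^sub>m T \<and> complex_of_real ` K \<subseteq> essential_spectrum T"
proof -
  let ?D = "\<rat> \<inter> gap_interval a b"
  obtain c where c: "c \<in> gap_interval a b"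
    using ereal_dense2[of a "ereal b"] assms(5) unfolding has_gap_def gap_interval_def by auto
  \<comment> \<open>Only nonemptiness of \<open>?D\<close> is drawn from this, so that a sequence
    can enumerate it.\<close>
  have "c islimpt ?D"
    using c closure_subset by (intro islimpt_rationals_open open_gap_interval) auto
  then have "?D \<noteq> {}" using islimpt_EMPTY by metis
  moreover have "countable ?D" using countable_rat by blast
  ultimately obtain l :: "nat \<Rightarrow> real" where l: "range l = ?D"
    using range_from_nat_into[of ?D] that by blast
  then have l_gap: "l n \<in> gap_interval a b" for n by blast
  obtain u where u: "orthonormal_sequence u" "\<And>n. u n \<in> deficiency_space S (of_real (l n))"
    by (rule exists_orthonormal_sequence[of "\<lambda>n. deficiency_space S (of_real (l n))"])
      (assumption | rule that cvs_subspace_deficiency_space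
        infinite_dimensional_deficiency_space[OF assms(2-6) l_gap])+
  interpret orthonormal_sequence u by (rule u)
  obtain p q r where pqr: "p \<ge> 0" "\<And>x. x \<in> gap_interval a b \<Longrightarrow> p * x\<^sup>2 + q * x + r < 0"
    "\<And>f. f \<in> dom S \<Longrightarrow> p * (norm (S \<bullet>\<bullet> f))\<^sup>2 + q * inner f (S \<bullet>\<bullet> f) + r * (norm f)\<^sup>2 \<ge> 0"
    by (rule has_gap_quadratic_form[OF assms(5)]) (assumption | rule that)+
  have eig: "cinner (u n) (S \<bullet>\<bullet> f) = l n * cinner (u n) f" if "f \<in> dom S" for n f
    using u(2)[of n] that by (simp add: deficiency_space_def)
  obtain T where T: "self_adjoint T" "S \<subseteq>\<^sub>m T" "\<And>n. T (u n) = Some (l n *\<^sub>R u n)"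
    by (rule self_adjoint_extension_with_eigenvectors[OF assms(2-4) eig pqr(1)
          less_imp_le[OF pqr(2)[OF l_gap]] pqr(2)[OF c] pqr(3)])
      (assumption | rule that)+
  have norm_u: "norm (u n) = 1" for n
    using orthonormal[of n n] power2_eq_iff_nonneg[of "norm (u n)" 1]
    by (simp add: cinner_self flip: of_real_power)
  have "complex_of_real x \<in> essential_spectrum T" if "x \<in> K" for x
  \<comment> \<open>The eigenvalues exhaust the rationals of the gap, so endpoints in
    \<open>K\<close> are limit points of them as well as interior points.\<close>
  proof (rule dense_eigenvalues_essential_spectrum[where T = T and u = u and l = l, OF T(3) norm_u])
    have "x \<in> closure (gap_interval a b)" using that assms(8) by blast
    then show "x islimpt range l"
      unfolding l by (rule islimpt_rationals_open[OF open_gap_interval])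
  qed
  then have "complex_of_real ` K \<subseteq> essential_spectrum T" by blast
  with T(1,2) show ?thesis by blast
qed

end
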